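(* The following hold. (i) For every integer $v\ge 32$ with $v\equiv 4,8,28,32,44,52\pmod{60}$ and every positive integer $m\le (v-1)/30$ there is a simple $3-\bigl(2v,7,\tfrac{35}{4}v(v-2)(v-3)m\bigr)$ design that is $(1,7v/2)$-resolvable. (ii) For every integer $v>6$ with $v\equiv 5,17,35,47\pmod{60}$ and every positive integer $m\le (v-1)/2$ there is a simple $3-\bigl(2v,8,\tfrac{7}{30}v(v-2)(v-3)(v-5)m\bigr)$ design that is $(1,8v)$-resolvable. (iii) For every integer $v>8$ with $v\equiv 7,23,63,111,167,191,223,231,247\pmod{280}$ and every positive integer $m\le (v-1)/2$ such that $m$ is even or $16\mid (v-7)$, there is a simple $3-\Bigl(2v,10,\frac{81\,v\,m}{7(v-5)}\binom{v-2}{6}\Bigr)$ design that is $(1,10v)$-resolvable.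
   Context: A $t-(v,k,\lambda)$ design is a pair $(X,\mathcal B)$ with $|X|=v$ and $\mathcal B$ a collection of $k$-subsets (blocks) of $X$ such that every $t$-subset of $X$ is contained in exactly $\lambda$ blocks. It is simple if it has no repeated blocks. A design $(X,\mathcal B)$ with block size $k$ on $v$ points is $(1,\sigma)$-resolvable if $\mathcal B$ can be partitioned into $w\ge 2$ classes $\pi_1,\ldots,\pi_w$ such that each $(X,\pi_i)$ is a $1-(v,k,\sigma)$ design, i.e. every point lies in exactly $\sigma$ blocks of each class. *)

theory Defs
  imports Complex_Main "HOL-Library.Multiset"
begin

text \<open>Blocks form a multiset, so that repeated blocks are possible and simplicity is a
  genuine condition. No relation between \<open>t\<close>, \<open>k\<close> and \<open>v\<close> is imposed.\<close>

definition t_design ::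
    "nat \<Rightarrow> nat \<Rightarrow> nat \<Rightarrow> nat \<Rightarrow> 'a set \<Rightarrow> 'a set multiset \<Rightarrow> bool" where
  "t_design t v k lam X \<B> \<longleftrightarrow>
     finite X \<and> card X = v \<and>
     (\<forall>b \<in># \<B>. b \<subseteq> X \<and> card b = k) \<and>
     (\<forall>T. T \<subseteq> X \<and> card T = t \<longrightarrow> size {#b \<in># \<B>. T \<subseteq> b#} = lam)"

definition simple_blocks :: "'a set multiset \<Rightarrow> bool" where
  "simple_blocks \<B> \<longleftrightarrow> (\<forall>b. count \<B> b \<le> 1)"

text \<open>A partition of the block multiset into \<open>w\<close> classes is a decomposition of it as a
  multiset sum of \<open>w\<close> nonempty multisets, so a repeated block may be spread over several
  classes, each copy lying in exactly one of them.\<close>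

definition one_resolvable ::
    "nat \<Rightarrow> nat \<Rightarrow> nat \<Rightarrow> 'a set \<Rightarrow> 'a set multiset \<Rightarrow> bool" where
  "one_resolvable v k \<sigma> X \<B> \<longleftrightarrow>
     (\<exists>w \<ge> 2. \<exists>\<pi> :: nat \<Rightarrow> 'a set multiset.
        \<B> = (\<Sum>i<w. \<pi> i) \<and>
        (\<forall>i<w. \<pi> i \<noteq> {#} \<and> t_design 1 v k \<sigma> X (\<pi> i)))"

text \<open>The parameters \<open>l\<close> and \<open>s\<close> are given as real expressions, since the formulas for them
  contain fractions; the predicate includes that they are natural numbers.\<close>

definition exists_simple_resolvable_3_design :: "nat \<Rightarrow> nat \<Rightarrow> real \<Rightarrow> real \<Rightarrow> bool" where
  "exists_simple_resolvable_3_design v k l s \<longleftrightarrow>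
     (\<exists>(lam::nat) (\<sigma>::nat) (X :: nat set) \<B>.
        real lam = l \<and> real \<sigma> = s \<and>
        t_design 3 v k lam X \<B> \<and> simple_blocks \<B> \<and> one_resolvable v k \<sigma> X \<B>)"

end

theory Submission
  imports Defs "HOL-Library.Disjoint_Sets" "HOL-Number_Theory.Cong"
begin

text \<open>The points are two copies of \<open>{..<v}\<close>, and a block is a union of a subset \<open>A\<close> of the first copy
and a subset \<open>B\<close> of the second, so a design is a set \<open>P\<close> of pairs \<open>(A, B)\<close>. A triple of points
meets one of the copies in at most one point. Hence the number of blocks through it is under
control as soon as, for every \<open>j\<close>-set \<open>A\<close>, each point lies in the same number \<open>R\<close> of partners
\<open>B\<close> of \<open>A\<close>, and symmetrically with a number \<open>S\<close> for the partners of every \<open>l\<close>-set \<open>B\<close>: a point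
of the second copy together with a set \<open>T\<close> in the first lies in \<open>R\<close> blocks for every \<open>j\<close>-set
containing \<open>T\<close> (\<open>cover_counts\<close>). Such sets of pairs are called balanced.

Balanced sets come from resolutions of all \<open>j\<close>-sets and of all \<open>l\<close>-sets into classes in which
every point has the same degree: take a bipartite graph between the two collections of classes and
join \<open>A\<close> to \<open>B\<close> whenever their classes are adjacent (\<open>balanced_blowup\<close>). If \<open>k\<close> is coprime to
\<open>v\<close>, the orbits of \<open>k\<close>-sets under translation modulo \<open>v\<close> are such classes, because no \<open>k\<close>-set is
fixed by a nontrivial translation (\<open>coprime_regular_partition\<close>). A bipartite graph
with prescribed row degrees and constant column degree is obtained by filling the columns cyclically
(\<open>bipartite_degrees\<close>).

It remains to choose the sizes \<open>(j, l)\<close> and the degrees so that triples inside a copy and triples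
meeting both copies are covered equally often.

For block size \<open>k = 2h\<close>, with \<open>k = 8\<close> or \<open>k = 10\<close>, the sizes are \<open>(2, k - 2)\<close>, \<open>(k - 2, 2)\<close>
and \<open>(h, h)\<close>. Each orbit of \<open>(k - 2)\<close>-sets is adjacent to \<open>m\<close> of the \<open>(v - 1) / 2\<close> orbits of
pairs; the balance condition then determines the degree \<open>d\<close> of the graph on the orbits of
\<open>h\<close>-sets, and the congruences on \<open>v\<close> are what makes all degrees integers. One edge of the first
graph together with its mirror image covers each point \<open>k v\<close> times, and so do two edges of the
second graph; this gives the resolution, \<open>d\<close> being even.

For block size 7 the sizes are \<open>(2, 5)\<close> and \<open>(3, 4)\<close> with their mirror images. Here \<open>v\<close> is a
multiple of 4, so pairs are resolved into \<open>v - 1\<close> perfect matchings, each orbit of 5-sets being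
adjacent to \<open>30 m\<close> of them. Among the 4-sets there are those invariant under the half turn
\<open>x \<mapsto> x + v / 2\<close>; they correspond to the edges of the complete graph on \<open>v / 2\<close> points and are
resolved into perfect matchings too, while the remaining ones form orbits of length \<open>v\<close>. Classes of
degree 4 and of degree 1 thus occur together, and the bipartite graph with the orbits of
3-sets must have constant weighted degree (\<open>weighted_bipartite_degrees\<close>).\<close>

section \<open>Regular families of subsets\<close>

definition ksubsets :: "nat \<Rightarrow> nat \<Rightarrow> nat set set" where
  "ksubsets v k = {A. A \<subseteq> {..<v} \<and> card A = k}"

definition deg :: "'a set set \<Rightarrow> 'a \<Rightarrow> nat" where
  "deg F x = card {A \<in> F. x \<in> A}"

definition regular :: "nat \<Rightarrow> nat \<Rightarrow> nat set set \<Rightarrow> bool" where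
  "regular v r F \<longleftrightarrow> (\<forall>x<v. deg F x = r)"

lemma finite_ksubsets [simp]: "finite (ksubsets v k)"
  by (rule finite_subset[of _ "Pow {..<v}"]) (auto simp: ksubsets_def)

lemma card_ksubsets: "card (ksubsets v k) = v choose k"
  unfolding ksubsets_def using n_subsets[of "{..<v}" k] by simp

lemma finite_in_ksubsets: "A \<in> ksubsets v k \<Longrightarrow> finite A"
  unfolding ksubsets_def using finite_subset[of A "{..<v}"] by auto

lemma ksubsets_disjoint: "j \<noteq> l \<Longrightarrow> ksubsets v j \<inter> ksubsets v l = {}"
  by (auto simp: ksubsets_def)

lemma ksubsets_nonempty: "k \<le> v \<Longrightarrow> ksubsets v k \<noteq> {}"
  using card_ksubsets[of v k] by (metis card.empty less_numeral_extra(3) zero_less_binomial)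

text \<open>Double counting of the incident pairs of a point and a member of \<open>F\<close>.\<close>

lemma regular_card:
  assumes "F \<subseteq> ksubsets v k" "regular v r F"
  shows "card F * k = v * r"
proof -
  have fin: "finite F"
    using assms(1) finite_subset finite_ksubsets by blast
  have "(\<Sum>A\<in>F. card {x \<in> {..<v}. x \<in> A}) = r * card {..<v}"
    by (rule sum_multicount) (use fin assms(2) in \<open>auto simp: regular_def deg_def\<close>)
  moreover have "card {x \<in> {..<v}. x \<in> A} = k" if "A \<in> F" for A
  proof -
    have "{x \<in> {..<v}. x \<in> A} = A"
      using that assms(1) by (auto simp: ksubsets_def)
    then show ?thesis
      using that assms(1) by (auto simp: ksubsets_def)
  qed
  ultimately show ?thesis
    by (simp add: mult.commute)
qed

lemma regular_partition_card:
  assumes "partition_on \<F> Q" "\<F> \<subseteq> ksubsets v k" "\<forall>F\<in>Q. regular v (r F) F"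
  shows "card \<F> * k = v * sum r Q"
proof -
  have fin: "finite \<F>"
    using assms(2) finite_subset finite_ksubsets by blast
  have "card \<F> * k = (\<Sum>F\<in>Q. card F * k)"
    using product_partition[OF assms(1)] fin partition_onD1[OF assms(1)]
    by (metis finite_subset Union_upper sum_distrib_right)
  also have "\<dots> = (\<Sum>F\<in>Q. v * r F)"
    using assms partition_onD1[OF assms(1)] by (intro sum.cong refl regular_card) auto
  finally show ?thesis
    by (simp add: sum_distrib_left)
qed

section \<open>Translation orbits\<close>

definition shift :: "nat \<Rightarrow> nat \<Rightarrow> nat set \<Rightarrow> nat set" where
  "shift v i B = (\<lambda>x. (x + i) mod v) ` B"

lemma shift_shift: "shift v i (shift v j B) = shift v (j + i) B"
  by (auto simp: shift_def image_image mod_add_left_eq add.assoc)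

lemma shift_cong: "[i = j] (mod v) \<Longrightarrow> shift v i B = shift v j B"
  using mod_add_cong[OF refl, of i v j] unfolding shift_def cong_def by simp

lemma shift_period:
  assumes "B \<subseteq> {..<v}" "[i = 0] (mod v)"
  shows "shift v i B = B"
proof -
  have "(\<lambda>x. (x + 0) mod v) ` B = (\<lambda>x. x) ` B"
    by (rule image_cong) (use assms(1) in auto)
  then show ?thesis
    using shift_cong[OF assms(2), of B] by (simp add: shift_def)
qed

lemma inj_on_shift: "inj_on (\<lambda>x. (x + i) mod v) {..<v::nat}"
proof (rule inj_onI)
  fix x y assume "x \<in> {..<v}" "y \<in> {..<v}" "(x + i) mod v = (y + i) mod v"
  then show "x = y"
    using cong_add_rcancel_nat[of x i y v] by (simp add: cong_def)
qed

lemma shift_ksubsets: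
  assumes "B \<in> ksubsets v k" shows "shift v i B \<in> ksubsets v k"
proof (cases "v = 0")
  case False
  have "inj_on (\<lambda>x. (x + i) mod v) B"
    using inj_on_shift inj_on_subset assms unfolding ksubsets_def by blast
  then show ?thesis
    using assms False by (auto simp: ksubsets_def shift_def card_image)
qed (use assms in \<open>auto simp: ksubsets_def shift_def\<close>)

lemma sum_shift:
  assumes "B \<in> ksubsets v k"
  shows "[\<Sum>(shift v i B) = \<Sum>B + k * i] (mod v)"
proof -
  have "inj_on (\<lambda>x. (x + i) mod v) B"
    using inj_on_shift inj_on_subset assms unfolding ksubsets_def by blast
  then have "\<Sum>(shift v i B) = (\<Sum>x\<in>B. (x + i) mod v)"
    by (simp add: shift_def sum.reindex)
  also have "[\<dots> = (\<Sum>x\<in>B. x + i)] (mod v)"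
    by (simp add: cong_def mod_sum_eq)
  also have "(\<Sum>x\<in>B. x + i) = \<Sum>B + k * i"
    using assms by (simp add: sum.distrib ksubsets_def)
  finally show ?thesis .
qed

text \<open>If no translation identifies two translates of a member, each orbit consists of \<open>v\<close> sets, one for
each translation. For a fixed point \<open>x\<close> and a fixed element \<open>b\<close> of \<open>B\<close> exactly one translation moves
\<open>b\<close> to \<open>x\<close>, so \<open>x\<close> lies in \<open>card B\<close> members of the orbit.\<close>

lemma orbit_partition:
  assumes v: "v > 0" and sub: "\<F> \<subseteq> ksubsets v k"
    and inv: "\<And>B i. B \<in> \<F> \<Longrightarrow> shift v i B \<in> \<F>"
    and free: "\<And>B i j. B \<in> \<F> \<Longrightarrow> i < v \<Longrightarrow> j < v \<Longrightarrow> shift v i B = shift v j B \<Longrightarrow> i = j"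
  obtains Q where "partition_on \<F> Q" "\<forall>F\<in>Q. regular v k F"
proof
  define orb where "orb B = (\<lambda>i. shift v i B) ` {..<v}" for B
  \<comment> \<open>Orbits with a common member coincide: a translation by \<open>i\<close> is undone by one by \<open>v - i mod v\<close>.\<close>
  have orb_mono: "orb B \<subseteq> orb C" if "shift v i B = shift v j C" "j < v" "B \<subseteq> {..<v}" for B C i j
  proof
    fix A assume "A \<in> orb B"
    then obtain s where s: "A = shift v s B"
      by (auto simp: orb_def)
    have "A = shift v ((v - i mod v) + i + s) B"
    proof -
      have "[(v - i mod v) + i + s = s] (mod v)"
      proof -
        have "[i = i mod v] (mod v)"
          by (simp add: cong_def)
        then have "[(v - i mod v) + i = (v - i mod v) + i mod v] (mod v)"
          by (rule cong_add[OF cong_refl])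
        moreover have "(v - i mod v) + i mod v = v"
          using v by simp
        ultimately have "[(v - i mod v) + i = 0] (mod v)"
          by (simp add: cong_def)
        then have "[(v - i mod v) + i + s = 0 + s] (mod v)"
          by (rule cong_add[OF _ cong_refl])
        then show ?thesis by simp
      qed
      then show ?thesis
        unfolding s using shift_cong cong_sym by blast
    qed
    also have "\<dots> = shift v (s + (v - i mod v)) (shift v i B)"
      by (simp add: shift_shift algebra_simps)
    also have "\<dots> = shift v (j + (s + (v - i mod v))) C"
      by (simp add: that shift_shift)
    also have "\<dots> = shift v ((j + (s + (v - i mod v))) mod v) C"
      by (rule shift_cong) (simp add: cong_def)
    finally show "A \<in> orb C"
      unfolding orb_def using v by auto
  qed
  have in_orb: "B \<in> orb B" if "B \<in> \<F>" for B
    unfolding orb_def using v that sub shift_period[of B v 0]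
    by (intro image_eqI[of _ _ 0]) (auto simp: ksubsets_def)
  show "partition_on \<F> (orb ` \<F>)"
  proof (rule partition_onI)
    show "\<Union> (orb ` \<F>) = \<F>"
      using in_orb inv by (auto simp: orb_def)
    show "{} \<notin> orb ` \<F>"
      using in_orb by blast
    fix p q assume pq: "p \<in> orb ` \<F>" "q \<in> orb ` \<F>" "p \<noteq> q"
    then obtain B C where BC: "B \<in> \<F>" "C \<in> \<F>" "p = orb B" "q = orb C"
      by auto
    show "disjnt p q"
    proof (rule ccontr)
      assume "\<not> disjnt p q"
      then obtain i j where "shift v i B = shift v j C" "i < v" "j < v"
        unfolding BC orb_def disjnt_def by auto
      moreover have "B \<subseteq> {..<v}" "C \<subseteq> {..<v}"
        using BC sub by (auto simp: ksubsets_def)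
      ultimately have "orb B = orb C"
        using orb_mono[of i B j C] orb_mono[of j C i B] by auto
      then show False using BC pq by simp
    qed
  qed
  show "\<forall>F\<in>orb ` \<F>. regular v k F"
  proof (clarsimp simp: regular_def)
    fix B x assume B: "B \<in> \<F>" and x: "x < v"
    have Bv: "B \<subseteq> {..<v}" "card B = k"
      using B sub by (auto simp: ksubsets_def)
    have "{A \<in> orb B. x \<in> A} = (\<lambda>i. shift v i B) ` {i. i < v \<and> x \<in> shift v i B}"
      by (auto simp: orb_def)
    moreover have "inj_on (\<lambda>i. shift v i B) {i. i < v \<and> x \<in> shift v i B}"
      by (rule inj_onI) (use free[OF B] in auto)
    ultimately have "deg (orb B) x = card {i. i < v \<and> x \<in> shift v i B}"
      by (simp add: deg_def card_image)
    also have "{i. i < v \<and> x \<in> shift v i B} = (\<lambda>b. (x + (v - b)) mod v) ` B"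
    proof (intro equalityI subsetI)
      fix i assume "i \<in> {i. i < v \<and> x \<in> shift v i B}"
      then obtain b where b: "b \<in> B" "x = (b + i) mod v" "i < v"
        by (auto simp: shift_def)
      have "(x + (v - b)) mod v = (b + i + (v - b)) mod v"
        using b by (simp add: mod_add_left_eq)
      also have "b + i + (v - b) = i + v"
        using b Bv by auto
      finally have "(x + (v - b)) mod v = i"
        using b by simp
      then show "i \<in> (\<lambda>b. (x + (v - b)) mod v) ` B"
        using b(1) by (intro image_eqI[of _ _ b]) simp_all
    next
      fix i assume "i \<in> (\<lambda>b. (x + (v - b)) mod v) ` B"
      then obtain b where b: "b \<in> B" "i = (x + (v - b)) mod v"
        by auto
      have "(b + i) mod v = (b + (x + (v - b))) mod v"
        using b by (simp add: mod_add_right_eq)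
      also have "b + (x + (v - b)) = x + v"
        using b Bv by auto
      finally have "(b + i) mod v = x"
        using x by simp
      then have "x \<in> shift v i B"
        using b(1) by (force simp: shift_def)
      then show "i \<in> {i. i < v \<and> x \<in> shift v i B}"
        using b v by simp
    qed
    also have "card \<dots> = k"
    proof -
      have "inj_on (\<lambda>b. (x + (v - b)) mod v) B"
      proof (rule inj_onI)
        fix b c assume bc: "b \<in> B" "c \<in> B" "(x + (v - b)) mod v = (x + (v - c)) mod v"
        then have "[v - b = v - c] (mod v)"
          using cong_add_lcancel_nat[of x "v - b" "v - c" v] by (simp add: cong_def)
        then have "[v - b + (b + c) = v - c + (b + c)] (mod v)"
          by (rule cong_add[OF _ cong_refl])
        moreover have "v - b + (b + c) = c + v" "v - c + (b + c) = b + v"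
          using bc Bv by auto
        ultimately show "b = c"
          using bc(1,2) Bv(1) by (auto simp: cong_def subset_iff)
      qed
      then show ?thesis
        using Bv by (simp add: card_image)
    qed
    finally show "deg (orb B) x = k" .
  qed
qed

text \<open>Translating a \<open>k\<close>-set by \<open>i\<close> adds \<open>k * i\<close> to the sum of its elements modulo \<open>v\<close>. When \<open>k\<close> is a
unit modulo \<open>v\<close>, the sum therefore distinguishes all translates.\<close>

lemma coprime_regular_partition:
  assumes v: "v > 0" and cop: "coprime k v"
  obtains Q where "partition_on (ksubsets v k) Q" "\<forall>F\<in>Q. regular v k F"
proof (rule orbit_partition[OF v order_refl])
  fix B i j assume B: "B \<in> ksubsets v k" and ij: "i < v" "j < v" and eq: "shift v i B = shift v j B"
  have "[\<Sum>B + k * i = \<Sum>B + k * j] (mod v)"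
    using sum_shift[OF B, of i] sum_shift[OF B, of j] unfolding eq cong_def by simp
  then have "[k * i = k * j] (mod v)"
    by (simp add: cong_add_lcancel_nat)
  then have "[i = j] (mod v)"
    using cop by (simp add: cong_mult_lcancel_nat)
  then show "i = j"
    using ij by (simp add: cong_def)
qed (auto intro: shift_ksubsets)

section \<open>Perfect matchings\<close>

text \<open>The round-robin schedule: of the \<open>2n\<close> players, \<open>M = 2n - 1\<close> is kept aside, the others are the
residues modulo the odd number \<open>M\<close>. Players \<open>x\<close> and \<open>y\<close> meet in round \<open>x + y\<close>, and \<open>M\<close> takes the
place of the opponent that \<open>x\<close> would have in round \<open>2x\<close>, namely \<open>x\<close> itself.\<close>

lemma one_factorization:
  assumes "n > 0"
  obtains Q where "partition_on (ksubsets (2 * n) 2) Q" "\<forall>F\<in>Q. regular (2 * n) 1 F"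
proof -
  define M where "M = 2 * n - 1"
  have M: "2 * n = Suc M" "odd M"
    using assms by (auto simp: M_def)
  define col where "col x y = (if x = M then 2 * y mod M else if y = M then 2 * x mod M else (x + y) mod M)"
    for x y
  have col_sym: "col x y = col y x" for x y
    by (auto simp: col_def add.commute)
  have dbl: "a = b" if "(2 * a) mod M = (2 * b) mod M" "a < M" "b < M" for a b
  proof -
    have "[2 * a = 2 * b] (mod M)"
      using that by (simp add: cong_def)
    moreover have "coprime 2 M" using M by simp
    ultimately have "[a = b] (mod M)"
      by (simp add: cong_mult_lcancel_nat)
    then show ?thesis using that by (simp add: cong_def)
  qed
  have canc: "a = b" if "(x + a) mod M = (x + b) mod M" "a < M" "b < M" for a b x
    using that cong_add_lcancel_nat[of x a b M] by (simp add: cong_def)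
  have inj: "inj_on (col x) ({..<2 * n} - {x})" if "x < 2 * n" for x
  proof (rule inj_onI)
    fix y z assume yz: "y \<in> {..<2 * n} - {x}" "z \<in> {..<2 * n} - {x}" "col x y = col x z"
    have lt: "x \<le> M" "y \<le> M" "z \<le> M"
      using that yz M by auto
    show "y = z"
    proof (cases "x = M")
      case True
      then show ?thesis using yz lt dbl[of y z] by (auto simp: col_def)
    next
      case False
      then show ?thesis
        using yz lt canc[of x y z] canc[of x x z] canc[of x y x]
        by (auto simp: col_def mult_2 split: if_splits)
    qed
  qed
  \<comment> \<open>By counting, each player meets somebody in every round.\<close>
  have img: "col x ` ({..<2 * n} - {x}) = {..<M}" if "x < 2 * n" for x
  proof (rule card_subset_eq)
    have "M > 0" using M(2) by (cases M) auto
    then show "col x ` ({..<2 * n} - {x}) \<subseteq> {..<M}"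
      by (auto simp: col_def)
    show "card (col x ` ({..<2 * n} - {x})) = card {..<M}"
      using that M by (subst card_image[OF inj[OF that]]) simp
  qed simp
  define fac where "fac c = {{x, y} |x y. x < 2 * n \<and> y < 2 * n \<and> x \<noteq> y \<and> col x y = c}" for c
  have reg: "regular (2 * n) 1 (fac c)" if "c < M" for c
    unfolding regular_def
  proof (intro allI impI)
    fix x assume x: "x < 2 * n"
    have "c \<in> col x ` ({..<2 * n} - {x})"
      using img[OF x] that by simp
    then obtain y where y: "y < 2 * n" "y \<noteq> x" "col x y = c"
      by auto
    have uniq: "z = y" if "z < 2 * n" "z \<noteq> x" "col x z = c" for z
      using inj_onD[OF inj[OF x], of z y] that y by auto
    have "{A \<in> fac c. x \<in> A} = {{x, y}}"
    proof (intro equalityI subsetI)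
      fix A assume "A \<in> {A \<in> fac c. x \<in> A}"
      then obtain a b where ab: "A = {a, b}" "a < 2 * n" "b < 2 * n" "a \<noteq> b" "col a b = c" "x = a \<or> x = b"
        by (auto simp: fac_def)
      then show "A \<in> {{x, y}}"
        using uniq col_sym by (auto simp: insert_commute)
    qed (use x y in \<open>auto simp: fac_def\<close>)
    then show "deg (fac c) x = 1"
      by (simp add: deg_def)
  qed
  have part: "partition_on (ksubsets (2 * n) 2) (fac ` {..<M})"
  proof (rule partition_onI)
    show "\<Union> (fac ` {..<M}) = ksubsets (2 * n) 2"
    proof (intro equalityI subsetI)
      fix A assume "A \<in> ksubsets (2 * n) 2"
      then obtain x y where xy: "A = {x, y}" "x \<noteq> y" "x < 2 * n" "y < 2 * n"
        by (auto simp: ksubsets_def card_2_iff)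
      then have "A \<in> fac (col x y)" by (auto simp: fac_def)
      moreover have "col x y < M"
        using img[of x] xy by blast
      ultimately show "A \<in> \<Union> (fac ` {..<M})" by blast
    qed (auto simp: fac_def ksubsets_def card_2_iff)
    fix p q assume "p \<in> fac ` {..<M}" "q \<in> fac ` {..<M}" "p \<noteq> q"
    then obtain c d where cd: "p = fac c" "q = fac d" "c \<noteq> d" by auto
    then show "disjnt p q"
      using col_sym by (auto simp: disjnt_def fac_def doubleton_eq_iff)
  next
    show "{} \<notin> fac ` {..<M}"
    proof
      assume "{} \<in> fac ` {..<M}"
      then obtain c where "c < M" "fac c = {}" by auto
      then have "deg (fac c) 0 = 1"
        using reg[of c] assms unfolding regular_def by simp
      then show False unfolding \<open>fac c = {}\<close> by (simp add: deg_def)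
    qed
  qed
  show ?thesis
    by (rule that[OF part]) (use reg in auto)
qed

section \<open>Four-subsets of a set whose size is divisible by four\<close>

text \<open>Viewing \<open>{..<2n}\<close> as the set of antipodal pairs of the cycle \<open>{..<4n}\<close>, this is the union of the
antipodal pairs in \<open>e\<close>.\<close>

definition double_edge :: "nat \<Rightarrow> nat set \<Rightarrow> nat set" where
  "double_edge n e = e \<union> (+) (2 * n) ` e"

lemma double_edge_mem:
  assumes "e \<subseteq> {..<2 * n}"
  shows "x < 2 * n \<Longrightarrow> x \<in> double_edge n e \<longleftrightarrow> x \<in> e" "2 * n + x \<in> double_edge n e \<longleftrightarrow> x \<in> e"
  using assms by (auto simp: double_edge_def)

lemma half_turn_invariant_4_subsets:
  assumes n: "n > 0"
  shows "double_edge n ` ksubsets (2 * n) 2 = {B \<in> ksubsets (4 * n) 4. shift (4 * n) (2 * n) B = B}"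
proof (intro equalityI subsetI)
  fix B assume "B \<in> double_edge n ` ksubsets (2 * n) 2"
  then obtain e where e: "e \<subseteq> {..<2 * n}" "card e = 2" "B = double_edge n e"
    by (auto simp: ksubsets_def)
  have fin: "finite e" using e(1) finite_subset by auto
  have "card B = card e + card ((+) (2 * n) ` e)"
    unfolding e(3) double_edge_def using fin e(1) by (intro card_Un_disjoint) auto
  then have B: "B \<in> ksubsets (4 * n) 4"
    using e by (auto simp: ksubsets_def card_image double_edge_def)
  have "shift (4 * n) (2 * n) B = (\<lambda>x. (x + 2 * n) mod (4 * n)) ` e \<union> (\<lambda>x. (2 * n + x + 2 * n) mod (4 * n)) ` e"
    by (simp add: e(3) double_edge_def shift_def image_Un image_image)
  also have "(\<lambda>x. (x + 2 * n) mod (4 * n)) ` e = (+) (2 * n) ` e"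
    by (rule image_cong) (use e(1) in auto)
  also have "(\<lambda>x. (2 * n + x + 2 * n) mod (4 * n)) ` e = (\<lambda>x. x) ` e"
  proof (rule image_cong)
    fix x assume "x \<in> e"
    then have "x < 4 * n" using e(1) by auto
    moreover have "2 * n + x + 2 * n = x + 4 * n" by simp
    ultimately show "(2 * n + x + 2 * n) mod (4 * n) = x" by simp
  qed simp
  finally have "shift (4 * n) (2 * n) B = B"
    by (auto simp: e(3) double_edge_def)
  then show "B \<in> {B \<in> ksubsets (4 * n) 4. shift (4 * n) (2 * n) B = B}" using B by simp
next
  fix B assume "B \<in> {B \<in> ksubsets (4 * n) 4. shift (4 * n) (2 * n) B = B}"
  then have B: "B \<subseteq> {..<4 * n}" "card B = 4" "shift (4 * n) (2 * n) B = B"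
    by (auto simp: ksubsets_def)
  have turn: "(x + 2 * n) mod (4 * n) \<in> B" if "x \<in> B" for x
    using that B(3) unfolding shift_def by blast
  define e where "e = B \<inter> {..<2 * n}"
  have up: "2 * n + x \<in> B \<longleftrightarrow> x \<in> B" if "x < 2 * n" for x
  proof
    assume "x \<in> B"
    then show "2 * n + x \<in> B" using turn[of x] that by (simp add: add.commute)
  next
    assume "2 * n + x \<in> B"
    moreover have "2 * n + x + 2 * n = x + 4 * n" by simp
    ultimately show "x \<in> B" using turn[of "2 * n + x"] that by simp
  qed
  have Be: "B = double_edge n e"
  proof (intro equalityI subsetI)
    fix x assume x: "x \<in> B"
    show "x \<in> double_edge n e"
    proof (cases "x < 2 * n")
      case False
      then have "x = 2 * n + (x - 2 * n)" "x - 2 * n < 2 * n" using x B(1) by auto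
      moreover from this have "x - 2 * n \<in> e" using up[of "x - 2 * n"] x by (simp add: e_def)
      ultimately show ?thesis unfolding double_edge_def by blast
    qed (use x in \<open>simp add: double_edge_def e_def\<close>)
  qed (use up in \<open>auto simp: double_edge_def e_def\<close>)
  have "card B = card e + card ((+) (2 * n) ` e)"
    unfolding Be double_edge_def by (intro card_Un_disjoint) (auto simp: e_def)
  then have "card e = 2" using B(2) by (simp add: card_image)
  then have "e \<in> ksubsets (2 * n) 2" by (auto simp: ksubsets_def e_def)
  then show "B \<in> double_edge n ` ksubsets (2 * n) 2" using Be by blast
qed

text \<open>The translation by \<open>t\<close> fixes the sum modulo \<open>4n\<close> of a 4-set only if \<open>n\<close> divides \<open>t\<close>. A 4-set with
a nontrivial stabiliser is then invariant under the half turn, since \<open>t\<close> or \<open>2t\<close> is the half turn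
modulo \<open>4n\<close>. So the orbits of the other 4-sets are full, and the invariant 4-sets inherit a
resolution from the one-factorization of the complete graph on the \<open>2n\<close> antipodal pairs.\<close>

lemma four_subsets_partition:
  assumes n: "n > 0"
  obtains L S where "partition_on (ksubsets (4 * n) 4) (L \<union> S)" "L \<inter> S = {}"
    "\<forall>F\<in>L. regular (4 * n) 4 F" "\<forall>F\<in>S. regular (4 * n) 1 F" "card S = 2 * n - 1"
proof -
  let ?v = "4 * n"
  define \<S> where "\<S> = {B \<in> ksubsets ?v 4. shift ?v (2 * n) B = B}"
  define \<L> where "\<L> = ksubsets ?v 4 - \<S>"
  obtain Q where Q: "partition_on (ksubsets (2 * n) 2) Q" "\<forall>F\<in>Q. regular (2 * n) 1 F"
    using one_factorization[OF n] by blast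
  let ?S = "(`) (double_edge n) ` Q"
  have inj: "inj_on (double_edge n) (ksubsets (2 * n) 2)"
  proof (rule inj_onI)
    fix e f assume "e \<in> ksubsets (2 * n) 2" "f \<in> ksubsets (2 * n) 2" and eq: "double_edge n e = double_edge n f"
    then have "e \<subseteq> {..<2 * n}" "f \<subseteq> {..<2 * n}" by (auto simp: ksubsets_def)
    from double_edge_mem(2)[OF this(1)] double_edge_mem(2)[OF this(2)] eq show "e = f" by auto
  qed
  have "{} \<notin> Q" using Q(1) by (rule partition_onD3)
  then have "?S - {{}} = ?S" by auto
  then have partS: "partition_on \<S> ?S"
    using partition_on_inj_image[OF Q(1) inj] half_turn_invariant_4_subsets[OF n] by (simp add: \<S>_def)
  have regS: "regular ?v 1 F" if FS: "F \<in> ?S" for F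
    unfolding regular_def
  proof (intro allI impI)
    fix x assume x: "x < ?v"
    obtain G where G: "G \<in> Q" "F = double_edge n ` G" using FS by auto
    have sub: "G \<subseteq> ksubsets (2 * n) 2" using G(1) Q(1) by (auto simp: partition_on_def)
    then have e: "e \<subseteq> {..<2 * n}" if "e \<in> G" for e using that by (auto simp: ksubsets_def)
    define y where "y = (if x < 2 * n then x else x - 2 * n)"
    have y: "y < 2 * n" using x by (auto simp: y_def)
    have mem: "x \<in> double_edge n e \<longleftrightarrow> y \<in> e" if "e \<in> G" for e
      using double_edge_mem[OF e[OF that], of y] y by (cases "x < 2 * n") (simp_all add: y_def)
    have "{A \<in> F. x \<in> A} = double_edge n ` {e \<in> G. y \<in> e}"
      unfolding G(2) using mem by auto
    moreover have "inj_on (double_edge n) {e \<in> G. y \<in> e}"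
      by (rule inj_on_subset[OF inj]) (use sub in auto)
    ultimately have "deg F x = deg G y" by (simp add: deg_def card_image)
    then show "deg F x = 1" using Q(2) G(1) y by (simp add: regular_def)
  qed
  have "\<exists>L. partition_on \<L> L \<and> (\<forall>F\<in>L. regular ?v 4 F)"
  proof (rule orbit_partition[of ?v \<L> 4])
    show "0 < ?v" using n by simp
    show "\<L> \<subseteq> ksubsets ?v 4" by (auto simp: \<L>_def)
    show "shift ?v i B \<in> \<L>" if B: "B \<in> \<L>" for B i
    proof -
      have Bk: "B \<in> ksubsets ?v 4" "shift ?v (2 * n) B \<noteq> B" using B by (auto simp: \<L>_def \<S>_def)
      have "shift ?v (2 * n) (shift ?v i B) \<noteq> shift ?v i B"
      proof
        assume eq: "shift ?v (2 * n) (shift ?v i B) = shift ?v i B"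
        define j where "j = ?v - i mod ?v"
        have "[i + j = 0] (mod ?v)"
        proof -
          have "[i + j = i mod ?v + j] (mod ?v)" by (rule cong_add[OF _ cong_refl]) (simp add: cong_def)
          moreover have "i mod ?v + j = ?v" using n by (simp add: j_def)
          ultimately show ?thesis by (simp add: cong_def)
        qed
        then have per: "shift ?v (i + j) B = B"
          using shift_period Bk(1) by (auto simp: ksubsets_def)
        have "shift ?v (2 * n) (shift ?v (i + j) B) = shift ?v j (shift ?v (2 * n) (shift ?v i B))"
          by (simp add: shift_shift algebra_simps)
        also have "\<dots> = shift ?v (i + j) B" unfolding eq by (simp add: shift_shift)
        finally show False using Bk(2) per by simp
      qed
      then show ?thesis using shift_ksubsets[OF Bk(1)] by (simp add: \<L>_def \<S>_def)
    qed
    have no_eq: False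
      if B: "B \<in> \<L>" and ij: "i < j" "j < ?v" and eq: "shift ?v i B = shift ?v j B" for B i j
    proof -
      have Bk: "B \<in> ksubsets ?v 4" "shift ?v (2 * n) B \<noteq> B" using B by (auto simp: \<L>_def \<S>_def)
      define t where "t = j - i"
      have "[\<Sum>B + 4 * i = \<Sum>B + 4 * j] (mod ?v)"
        using sum_shift[OF Bk(1), of i] sum_shift[OF Bk(1), of j] unfolding eq cong_def by simp
      then have "[4 * i = 4 * j] (mod ?v)" by (simp add: cong_add_lcancel_nat)
      then have "?v dvd 4 * j - 4 * i" using cong_altdef_nat[of "4 * i" "4 * j"] ij
        by (simp add: cong_sym_eq cong_altdef_nat)
      then have "n dvd t" unfolding t_def by (simp flip: diff_mult_distrib2)
      then obtain c where c: "t = n * c" by (rule dvdE)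
      have t: "t > 0" "t < ?v" using ij by (auto simp: t_def)
      then have "c > 0" "c < 4" using n c by auto
      have "shift ?v (?v - i) (shift ?v i B) = shift ?v ?v B"
        using ij by (simp add: shift_shift)
      moreover have "shift ?v (?v - i) (shift ?v j B) = shift ?v (?v + t) B"
        using ij by (simp add: shift_shift t_def add.commute)
      ultimately have "shift ?v ?v B = shift ?v (?v + t) B" using eq by simp
      moreover have "shift ?v ?v B = B" by (rule shift_period) (use Bk in \<open>auto simp: ksubsets_def cong_def\<close>)
      moreover have "shift ?v (?v + t) B = shift ?v t B" by (rule shift_cong) (simp add: cong_def)
      ultimately have per: "shift ?v t B = B" by simp
      have per2: "shift ?v (2 * t) B = B"
        using shift_shift[of ?v t t B] per by (simp add: mult_2)
      from \<open>c > 0\<close> \<open>c < 4\<close> consider "c = 1" | "c = 2" | "c = 3" by linarith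
      then show False
      proof cases
        case 1
        then show False using per2 c Bk(2) by (simp add: mult.commute)
      next
        case 2
        then show False using per c Bk(2) by (simp add: mult.commute)
      next
        case 3
        have "[2 * t = 2 * n] (mod ?v)" using 3 c by (simp add: cong_def)
        then show False using per2 Bk(2) shift_cong[of "2 * t" "2 * n" ?v B] by simp
      qed
    qed
    show "i = j" if "B \<in> \<L>" "i < ?v" "j < ?v" "shift ?v i B = shift ?v j B" for B i j
      using no_eq[of B i j] no_eq[of B j i] that by (metis linorder_less_linear)
  qed blast
  then obtain L where L: "partition_on \<L> L" "\<forall>F\<in>L. regular ?v 4 F" by auto
  have LS: "\<L> \<inter> \<S> = {}" "\<L> \<union> \<S> = ksubsets ?v 4" by (auto simp: \<L>_def \<S>_def)
  show ?thesis
  proof (rule that[of L ?S])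
    show "partition_on (ksubsets ?v 4) (L \<union> ?S)"
      unfolding LS(2)[symmetric] partition_on_def
    proof (intro conjI)
      show "\<Union> (L \<union> ?S) = \<L> \<union> \<S>" using L(1) partS by (simp add: partition_on_def Union_Un_distrib)
      show "disjoint (L \<union> ?S)"
        by (rule disjoint_union) (use L(1) partS LS(1) in \<open>auto simp: partition_on_def\<close>)
      show "{} \<notin> L \<union> ?S" using L(1) partS by (auto simp: partition_on_def)
    qed
    show "L \<inter> ?S = {}"
    proof (rule ccontr)
      assume "L \<inter> ?S \<noteq> {}"
      then obtain C where C: "C \<in> L" "C \<in> ?S" by blast
      then have "C \<subseteq> \<L>" "C \<subseteq> \<S>" "C \<noteq> {}" using L(1) partS by (auto simp: partition_on_def)
      then show False using LS(1) by blast
    qed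
    show "card ?S = 2 * n - 1"
    proof -
      have sub: "F \<subseteq> ksubsets (2 * n) 2" if "F \<in> Q" for F using that Q(1) by (auto simp: partition_on_def)
      have "inj_on ((`) (double_edge n)) Q"
        by (rule inj_onI) (metis inj inj_on_image_eq_iff sub)
      then have "card ?S = card Q" by (rule card_image)
      moreover have "(2 * n choose 2) * 2 = card Q * (2 * n)"
        using regular_partition_card[OF Q(1) order_refl Q(2)] by (simp add: card_ksubsets mult.commute)
      moreover have "(2 * n choose 2) * 2 = 2 * n * (2 * n - 1)" by (simp add: choose_two)
      ultimately show ?thesis using n by simp
    qed
    show "\<forall>F\<in>L. regular ?v 4 F" by (rule L(2))
    show "\<forall>F\<in>?S. regular ?v 1 F" using regS by blast
  qed
qed

section \<open>Bipartite graphs with given degrees\<close>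

text \<open>The rows are filled one after another, each with the next \<open>D i\<close> columns in cyclic order. As
\<open>D i \<le> q\<close>, a row never uses a column twice, and column \<open>c\<close> has been used as often as there are
numbers congruent to \<open>c\<close> below the number of entries placed so far.\<close>

lemma bipartite_degrees_residues:
  assumes "finite I" "q > 0" "\<forall>i\<in>I. D i \<le> q"
  shows "\<exists>E \<subseteq> I \<times> {..<q}. (\<forall>i\<in>I. card (E `` {i}) = D i) \<and>
    (\<forall>c<q. card (E\<inverse> `` {c}) = card {t. t < sum D I \<and> t mod q = c})"
  using assms(1,3)
proof (induction I rule: finite_induct)
  case empty
  then show ?case by auto
next
  case (insert a I)
  then obtain E where E: "E \<subseteq> I \<times> {..<q}" "\<forall>i\<in>I. card (E `` {i}) = D i"
    "\<forall>c<q. card (E\<inverse> `` {c}) = card {t. t < sum D I \<and> t mod q = c}"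
    by auto
  define N where "N = sum D I"
  define R where "R = (\<lambda>t. t mod q) ` {N..<N + D a}"
  have inj: "inj_on (\<lambda>t. t mod q) {N..<N + D a}"
  proof (rule inj_onI)
    fix s t assume st: "s \<in> {N..<N + D a}" "t \<in> {N..<N + D a}" "s mod q = t mod q"
    have "D a \<le> q" using insert.prems by simp
    then have "s - N < q" "t - N < q" using st by auto
    moreover have "[N + (s - N) = N + (t - N)] (mod q)"
      using st by (simp add: cong_def)
    then have "[s - N = t - N] (mod q)"
      by (simp only: cong_add_lcancel_nat)
    ultimately have "s - N = t - N" by (simp add: cong_def)
    then show "s = t" using st by auto
  qed
  define E' where "E' = E \<union> {a} \<times> R"
  have R: "R \<subseteq> {..<q}" "card R = D a"
    using assms(2) card_image[OF inj] by (auto simp: R_def)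
  have "E' \<subseteq> insert a I \<times> {..<q}"
    using E(1) R(1) by (auto simp: E'_def)
  moreover have "card (E' `` {i}) = D i" if "i \<in> insert a I" for i
  proof (cases "i = a")
    case True
    then have "E' `` {i} = R" using E(1) insert.hyps by (auto simp: E'_def)
    then show ?thesis using R True by simp
  next
    case False
    then have "E' `` {i} = E `` {i}" by (auto simp: E'_def)
    then show ?thesis using E(2) that False by simp
  qed
  moreover have "card (E'\<inverse> `` {c}) = card {t. t < sum D (insert a I) \<and> t mod q = c}" if c: "c < q" for c
  proof -
    have fin: "finite (E\<inverse> `` {c})"
      by (rule finite_subset[OF _ insert.hyps(1)]) (use E(1) in auto)
    have "E'\<inverse> `` {c} = E\<inverse> `` {c} \<union> (if c \<in> R then {a} else {})"
      by (auto simp: E'_def)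
    moreover have "a \<notin> E\<inverse> `` {c}" using E(1) insert.hyps by auto
    ultimately have "card (E'\<inverse> `` {c}) = card (E\<inverse> `` {c}) + (if c \<in> R then 1 else 0)"
      using fin by simp
    moreover have "card {t \<in> {N..<N + D a}. t mod q = c} = (if c \<in> R then 1 else 0)"
    proof (cases "c \<in> R")
      case True
      then obtain t where t: "t \<in> {N..<N + D a}" "t mod q = c" by (auto simp: R_def)
      then have "{t \<in> {N..<N + D a}. t mod q = c} = {t}"
        using inj by (auto dest: inj_onD)
      then show ?thesis using True by simp
    next
      case False
      then have "{t \<in> {N..<N + D a}. t mod q = c} = {}" by (auto simp: R_def)
      then show ?thesis using False by simp
    qed
    moreover have "{t. t < sum D (insert a I) \<and> t mod q = c} =
        {t. t < N \<and> t mod q = c} \<union> {t \<in> {N..<N + D a}. t mod q = c}"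
      using insert.hyps by (auto simp: N_def)
    moreover have "card ({t. t < N \<and> t mod q = c} \<union> {t \<in> {N..<N + D a}. t mod q = c}) =
        card {t. t < N \<and> t mod q = c} + card {t \<in> {N..<N + D a}. t mod q = c}"
      by (intro card_Un_disjoint) auto
    ultimately show ?thesis
      using E(3) c by (simp add: N_def)
  qed
  ultimately show ?case by blast
qed

lemma bipartite_degrees:
  assumes "finite I" "finite J" "\<forall>i\<in>I. D i \<le> card J" "sum D I = e * card J"
  obtains E where "E \<subseteq> I \<times> J" "\<forall>i\<in>I. card (E `` {i}) = D i" "\<forall>j\<in>J. card (E\<inverse> `` {j}) = e"
proof (cases "J = {}")
  case True
  then show ?thesis using that[of "{}"] assms(3) by auto
next
  case False
  define q where "q = card J"
  have q: "q > 0" using False assms(2) by (simp add: q_def card_gt_0_iff)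
  obtain h where h: "bij_betw h {..<q} J"
    using ex_bij_betw_nat_finite[OF assms(2)] by (auto simp: q_def lessThan_atLeast0)
  have hinj: "inj_on h {..<q}" and himg: "h ` {..<q} = J"
    using h by (auto simp: bij_betw_def)
  obtain E where E: "E \<subseteq> I \<times> {..<q}" "\<forall>i\<in>I. card (E `` {i}) = D i"
    "\<forall>c<q. card (E\<inverse> `` {c}) = card {t. t < sum D I \<and> t mod q = c}"
    using bipartite_degrees_residues[OF assms(1) q, of D] assms(3) by (auto simp: q_def)
  define E' where "E' = (\<lambda>(i, c). (i, h c)) ` E"
  have "E' \<subseteq> I \<times> J"
    using E(1) himg by (auto simp: E'_def)
  moreover have "card (E' `` {i}) = D i" if "i \<in> I" for i
  proof -
    have "E' `` {i} = h ` (E `` {i})" by (force simp: E'_def)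
    moreover have "inj_on h (E `` {i})"
      by (rule inj_on_subset[OF hinj]) (use E(1) in auto)
    ultimately show ?thesis using E(2) that by (simp add: card_image)
  qed
  moreover have "card (E'\<inverse> `` {j}) = e" if jJ: "j \<in> J" for j
  proof -
    obtain c where c: "c < q" "j = h c"
      using jJ unfolding himg[symmetric] by auto
    have "E'\<inverse> `` {j} = E\<inverse> `` {c}"
    proof (intro equalityI subsetI)
      fix i assume "i \<in> E'\<inverse> `` {j}"
      then obtain d where d: "(i, d) \<in> E" "h d = h c" using c by (auto simp: E'_def)
      then have "d = c" using inj_onD[OF hinj, of d c] E(1) c by auto
      then show "i \<in> E\<inverse> `` {c}" using d by auto
    qed (use c in \<open>force simp: E'_def\<close>)
    moreover have "{t. t < sum D I \<and> t mod q = c} = (\<lambda>s. s * q + c) ` {..<e}"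
    proof (intro equalityI subsetI)
      fix t assume t: "t \<in> {t. t < sum D I \<and> t mod q = c}"
      then have "t = (t div q) * q + c" by auto
      moreover have "t div q < e" using t assms(4) q
        by (simp add: q_def less_mult_imp_div_less)
      ultimately show "t \<in> (\<lambda>s. s * q + c) ` {..<e}" by blast
    next
      fix t assume "t \<in> (\<lambda>s. s * q + c) ` {..<e}"
      then obtain s where s: "s < e" "t = s * q + c" by auto
      have "t < Suc s * q" using c s by simp
      also have "\<dots> \<le> e * q" using s by (intro mult_right_mono) auto
      finally show "t \<in> {t. t < sum D I \<and> t mod q = c}"
        using s c assms(4) by (simp add: q_def)
    qed
    moreover have "inj_on (\<lambda>s. s * q + c) {..<e}"
      using q by (auto simp: inj_on_def)
    ultimately show ?thesis using E(3) c by (simp add: card_image)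
  qed
  ultimately show ?thesis using that by blast
qed

text \<open>Columns in \<open>L\<close> have weight 4 and those in \<open>S\<close> weight 1; every column has degree \<open>e\<close>, and the
weighted degree of every row is to be \<open>R\<close>. The columns of weight 4 are distributed as evenly as
possible, so that row degrees differ by at most one. The columns of weight 1 then make up what is
missing in each row, which by the two inequalities is neither negative nor more than \<open>card S\<close>.\<close>

lemma weighted_bipartite_degrees:
  assumes fin: "finite I" "finite L" "finite S" and LS: "L \<inter> S = {}"
    and total: "e * (4 * card L + card S) = card I * R"
    and e: "e \<le> card I" and low: "3 * card I < e * card S"
    and high: "e * card S + 4 * card I \<le> card I * (card S + 1)"
  obtains E where "E \<subseteq> I \<times> (L \<union> S)" "\<forall>G\<in>L \<union> S. card (E\<inverse> `` {G}) = e"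
    "\<forall>F\<in>I. (\<Sum>G\<in>E `` {F}. if G \<in> L then 4 else 1) = R"
proof -
  define p where "p = card I"
  define N where "N = e * card L"
  define f where "f = N div p"
  define s where "s = N mod p"
  have p0: "p > 0"
  proof (rule ccontr)
    assume "\<not> p > 0"
    then show False using e low by (simp add: p_def)
  qed
  have N: "N = p * f + s" "s < p" using p0 by (simp_all add: f_def s_def)
  \<comment> \<open>The rows in \<open>I'\<close> receive one column of weight 4 more than the others.\<close>
  obtain I' where I': "I' \<subseteq> I" "card I' = s"
    using obtain_subset_with_card_n[of s I] N(2) by (auto simp: p_def)
  have finI': "finite I'" using I'(1) fin(1) finite_subset by blast
  define D where "D i = f + (if i \<in> I' then 1 else 0)" for i
  have sumD: "sum D I = N"
  proof -
    have "sum D I = p * f + (\<Sum>i\<in>I. if i \<in> I' then 1 else 0)"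
      by (simp add: D_def sum.distrib p_def)
    also have "(\<Sum>i\<in>I. if i \<in> I' then 1 else (0::nat)) = card (I \<inter> I')"
      using fin(1) by (simp add: sum.If_cases)
    also have "I \<inter> I' = I'" using I' by auto
    finally show ?thesis using I' N by simp
  qed
  have pN: "N \<le> p * card L" using e by (simp add: N_def p_def)
  have DL: "D i \<le> card L" for i
  proof (cases "i \<in> I'")
    case True
    then have "s > 0" using I' finI' by (auto simp: card_gt_0_iff)
    then have "p * f < p * card L" using N pN by linarith
    then show ?thesis using True by (simp add: D_def)
  next
    case False
    have "p * f \<le> p * card L" using N pN by linarith
    then show ?thesis using False p0 by (simp add: D_def)
  qed
  obtain E1 where E1: "E1 \<subseteq> I \<times> L" "\<forall>i\<in>I. card (E1 `` {i}) = D i" "\<forall>j\<in>L. card (E1\<inverse> `` {j}) = e"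
    using bipartite_degrees[OF fin(1,2), of D e] DL sumD by (auto simp: N_def)
  have pR: "p * R = 4 * N + e * card S"
    using total by (simp add: p_def N_def algebra_simps)
  have D4: "4 * D i \<le> R" for i
  proof -
    have "4 * (p * f) \<le> 4 * N" using N by simp
    then have "p * (4 * (f + 1)) < p * (R + 1)" using pR low by (simp add: p_def algebra_simps)
    then have "4 * (f + 1) < R + 1" by (simp only: mult_less_cancel1)
    then show ?thesis by (simp add: D_def)
  qed
  have DS: "R - 4 * D i \<le> card S" for i
  proof -
    have "p * R < p * (4 * f + (card S + 1))" using pR N high by (simp add: p_def algebra_simps)
    then have "R < 4 * f + (card S + 1)" by (simp only: mult_less_cancel1)
    then show ?thesis by (simp add: D_def)
  qed
  have "(\<Sum>i\<in>I. R - 4 * D i) + 4 * sum D I = (\<Sum>i\<in>I. (R - 4 * D i) + 4 * D i)"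
    by (simp add: sum.distrib sum_distrib_left)
  also have "\<dots> = p * R" using D4 by (simp add: p_def)
  finally have sumR: "(\<Sum>i\<in>I. R - 4 * D i) = e * card S" using pR sumD by simp
  obtain E2 where E2: "E2 \<subseteq> I \<times> S" "\<forall>i\<in>I. card (E2 `` {i}) = R - 4 * D i" "\<forall>j\<in>S. card (E2\<inverse> `` {j}) = e"
    using bipartite_degrees[OF fin(1,3), of "\<lambda>i. R - 4 * D i" e] DS sumR by auto
  show ?thesis
  proof
    show "E1 \<union> E2 \<subseteq> I \<times> (L \<union> S)" using E1 E2 by auto
    show "\<forall>G\<in>L \<union> S. card ((E1 \<union> E2)\<inverse> `` {G}) = e"
    proof
      fix G assume "G \<in> L \<union> S"
      then consider "G \<in> L" "G \<notin> S" | "G \<in> S" "G \<notin> L" using LS by auto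
      then show "card ((E1 \<union> E2)\<inverse> `` {G}) = e"
      proof cases
        case 1
        then have "(E1 \<union> E2)\<inverse> `` {G} = E1\<inverse> `` {G}" using E2(1) by auto
        then show ?thesis using E1(3) 1 by simp
      next
        case 2
        then have "(E1 \<union> E2)\<inverse> `` {G} = E2\<inverse> `` {G}" using E1(1) by auto
        then show ?thesis using E2(3) 2 by simp
      qed
    qed
    show "\<forall>F\<in>I. (\<Sum>G\<in>(E1 \<union> E2) `` {F}. if G \<in> L then 4 else 1) = R"
    proof
      fix F assume F: "F \<in> I"
      have sub: "E1 `` {F} \<subseteq> L" "E2 `` {F} \<subseteq> S" using E1(1) E2(1) by auto
      have fins: "finite (E1 `` {F})" "finite (E2 `` {F})" using sub fin finite_subset by auto
      have "(E1 \<union> E2) `` {F} = E1 `` {F} \<union> E2 `` {F}" by auto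
      moreover have "E1 `` {F} \<inter> E2 `` {F} = {}" using sub LS by auto
      ultimately have "(\<Sum>G\<in>(E1 \<union> E2) `` {F}. if G \<in> L then 4 else (1::nat)) =
          (\<Sum>G\<in>E1 `` {F}. if G \<in> L then 4 else 1) + (\<Sum>G\<in>E2 `` {F}. if G \<in> L then 4 else 1)"
        using fins by (simp add: sum.union_disjoint)
      also have "(\<Sum>G\<in>E1 `` {F}. if G \<in> L then 4 else (1::nat)) = (\<Sum>G\<in>E1 `` {F}. 4)"
        by (rule sum.cong) (use sub in auto)
      also have "(\<Sum>G\<in>E2 `` {F}. if G \<in> L then 4 else (1::nat)) = (\<Sum>G\<in>E2 `` {F}. 1)"
        by (rule sum.cong) (use sub LS in auto)
      finally show "(\<Sum>G\<in>(E1 \<union> E2) `` {F}. if G \<in> L then 4 else 1) = R"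
        using E1(2) E2(2) F D4[of F] by simp
    qed
  qed
qed


section \<open>Balanced sets of pairs\<close>

text \<open>The set of partners of a \<open>j\<close>-set is a 1-design of degree \<open>R\<close>, the set of partners of an \<open>l\<close>-set
one of degree \<open>S\<close>.\<close>

definition balanced :: "nat \<Rightarrow> nat \<Rightarrow> nat \<Rightarrow> nat \<Rightarrow> nat \<Rightarrow> (nat set \<times> nat set) set \<Rightarrow> bool" where
  "balanced v j l R S P \<longleftrightarrow> P \<subseteq> ksubsets v j \<times> ksubsets v l \<and>
     (\<forall>A\<in>ksubsets v j. regular v R (P `` {A})) \<and> (\<forall>B\<in>ksubsets v l. regular v S (P\<inverse> `` {B}))"

definition cover_count :: "('a set \<times> 'b set) set \<Rightarrow> 'a set \<Rightarrow> 'b set \<Rightarrow> nat" where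
  "cover_count P T U = card {p \<in> P. T \<subseteq> fst p \<and> U \<subseteq> snd p}"

lemma balanced_converse: "balanced v j l R S P \<Longrightarrow> balanced v l j S R (P\<inverse>)"
  by (auto simp: balanced_def)

lemma balanced_finite: "balanced v j l R S P \<Longrightarrow> finite P"
  unfolding balanced_def by (meson finite_SigmaI finite_ksubsets finite_subset)

lemma cover_count_converse: "cover_count (P\<inverse>) T U = cover_count P U T"
proof -
  have "{p \<in> P\<inverse>. T \<subseteq> fst p \<and> U \<subseteq> snd p} = prod.swap ` {p \<in> P. U \<subseteq> fst p \<and> T \<subseteq> snd p}"
    by force
  then show ?thesis
    by (simp add: cover_count_def card_image)
qed

lemma cover_count_Un:
  assumes "finite P" "finite P'" "P \<inter> P' = {}"
  shows "cover_count (P \<union> P') T U = cover_count P T U + cover_count P' T U"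
proof -
  have "{p \<in> P \<union> P'. T \<subseteq> fst p \<and> U \<subseteq> snd p} =
      {p \<in> P. T \<subseteq> fst p \<and> U \<subseteq> snd p} \<union> {p \<in> P'. T \<subseteq> fst p \<and> U \<subseteq> snd p}"
    by auto
  then show ?thesis
    unfolding cover_count_def using assms by (simp add: card_Un_disjoint disjoint_iff)
qed

lemma card_supersets:
  assumes "T \<subseteq> {..<v}" "card T \<le> k"
  shows "card {A \<in> ksubsets v k. T \<subseteq> A} = (v - card T) choose (k - card T)"
proof -
  have fT: "finite T" using assms(1) finite_subset by auto
  have "bij_betw (\<lambda>B. B \<union> T) {B. B \<subseteq> {..<v} - T \<and> card B = k - card T} {A \<in> ksubsets v k. T \<subseteq> A}"
  proof (rule bij_betwI[where g = "\<lambda>A. A - T"])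
    show "(\<lambda>B. B \<union> T) \<in> {B. B \<subseteq> {..<v} - T \<and> card B = k - card T} \<rightarrow> {A \<in> ksubsets v k. T \<subseteq> A}"
    proof
      fix B assume B: "B \<in> {B. B \<subseteq> {..<v} - T \<and> card B = k - card T}"
      then have "finite B" by (auto intro: finite_subset[of _ "{..<v}"])
      moreover have "B \<inter> T = {}" using B by auto
      ultimately have "card (B \<union> T) = k" using B assms(2) fT by (simp add: card_Un_disjoint)
      then show "B \<union> T \<in> {A \<in> ksubsets v k. T \<subseteq> A}" using B assms by (auto simp: ksubsets_def)
    qed
    show "(\<lambda>A. A - T) \<in> {A \<in> ksubsets v k. T \<subseteq> A} \<rightarrow> {B. B \<subseteq> {..<v} - T \<and> card B = k - card T}"
      using fT by (auto simp: ksubsets_def card_Diff_subset)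
  qed auto
  then have "card {A \<in> ksubsets v k. T \<subseteq> A} = card {B. B \<subseteq> {..<v} - T \<and> card B = k - card T}"
    by (simp add: bij_betw_same_card)
  also have "\<dots> = card ({..<v} - T) choose (k - card T)"
    by (rule n_subsets) simp
  also have "card ({..<v} - T) = v - card T"
    using assms(1) fT by (simp add: card_Diff_subset)
  finally show ?thesis .
qed

lemma cover_count_left:
  assumes P: "balanced v j l R S P" and T: "T \<subseteq> {..<v}" "card T \<le> j"
  shows "cover_count P T {} * l = ((v - card T) choose (j - card T)) * (v * R)"
proof -
  let ?A = "{A \<in> ksubsets v j. T \<subseteq> A}"
  have PA: "P `` {A} \<subseteq> ksubsets v l" for A
    using P by (auto simp: balanced_def)
  have "{p \<in> P. T \<subseteq> fst p \<and> {} \<subseteq> snd p} = (SIGMA A:?A. P `` {A})"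
    using P by (auto simp: balanced_def)
  moreover have "card (SIGMA A:?A. P `` {A}) = (\<Sum>A\<in>?A. card (P `` {A}))"
    by (rule card_SigmaI) (use finite_subset[OF PA] in auto)
  ultimately have "cover_count P T {} * l = (\<Sum>A\<in>?A. card (P `` {A}) * l)"
    by (simp add: cover_count_def sum_distrib_right)
  also have "\<dots> = (\<Sum>A\<in>?A. v * R)"
    by (intro sum.cong refl regular_card PA) (use P in \<open>auto simp: balanced_def\<close>)
  finally show ?thesis
    using card_supersets[OF T] by simp
qed

text \<open>Every \<open>j\<close>-set containing \<open>T\<close> contributes exactly \<open>R\<close> pairs, whatever \<open>y\<close> is. This is the reason
why balance suffices: a triple split two to one between the copies has this shape on one side.\<close>

lemma cover_count_left_point:
  assumes P: "balanced v j l R S P" and T: "T \<subseteq> {..<v}" "card T \<le> j" and y: "y < v"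
  shows "cover_count P T {y} = ((v - card T) choose (j - card T)) * R"
proof -
  let ?A = "{A \<in> ksubsets v j. T \<subseteq> A}"
  have PA: "P `` {A} \<subseteq> ksubsets v l" for A
    using P by (auto simp: balanced_def)
  have "{p \<in> P. T \<subseteq> fst p \<and> {y} \<subseteq> snd p} = (SIGMA A:?A. {B \<in> P `` {A}. y \<in> B})"
    using P by (auto simp: balanced_def)
  moreover have "card (SIGMA A:?A. {B \<in> P `` {A}. y \<in> B}) = (\<Sum>A\<in>?A. deg (P `` {A}) y)"
    unfolding deg_def by (rule card_SigmaI) (use finite_subset[OF PA] in \<open>auto simp del: Image_singleton_iff\<close>)
  ultimately have "cover_count P T {y} = (\<Sum>A\<in>?A. deg (P `` {A}) y)"
    by (simp add: cover_count_def)
  also have "\<dots> = (\<Sum>A\<in>?A. R)"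
    by (intro sum.cong refl) (use P y in \<open>auto simp: balanced_def regular_def\<close>)
  finally show ?thesis
    using card_supersets[OF T] by simp
qed

lemma cover_count_left_eq_0:
  assumes P: "balanced v j l R S P" and T: "j < card T"
  shows "cover_count P T U = 0"
proof -
  have "{p \<in> P. T \<subseteq> fst p \<and> U \<subseteq> snd p} = {}"
  proof (rule ccontr)
    assume "{p \<in> P. T \<subseteq> fst p \<and> U \<subseteq> snd p} \<noteq> {}"
    then obtain A where "A \<in> ksubsets v j" "T \<subseteq> A"
      using P by (auto simp: balanced_def)
    then have "card T \<le> j"
      using card_mono[OF finite_in_ksubsets, of A v j T] by (simp add: ksubsets_def)
    then show False using T by simp
  qed
  then show ?thesis by (simp only: cover_count_def card.empty)
qed

text \<open>The four ways in which a triple can be distributed over the two copies. The multiplications on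
the left avoid division: \<open>cover_count_left\<close> counts the partners of a set, of which there are
\<open>v * R / l\<close>.\<close>

lemma cover_counts:
  assumes P: "balanced v j l R S P" and l: "l > 0" and j: "j > 0"
  shows "T \<subseteq> {..<v} \<Longrightarrow> card T = 3 \<Longrightarrow>
      cover_count P T {} * l = (if 3 \<le> j then ((v - 3) choose (j - 3)) * (v * R) else 0)"
    and "T \<subseteq> {..<v} \<Longrightarrow> card T = 3 \<Longrightarrow>
      cover_count P {} T * j = (if 3 \<le> l then ((v - 3) choose (l - 3)) * (v * S) else 0)"
    and "T \<subseteq> {..<v} \<Longrightarrow> card T = 2 \<Longrightarrow> y < v \<Longrightarrow>
      cover_count P T {y} = (if 2 \<le> j then ((v - 2) choose (j - 2)) * R else 0)"
    and "T \<subseteq> {..<v} \<Longrightarrow> card T = 2 \<Longrightarrow> y < v \<Longrightarrow>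
      cover_count P {y} T = (if 2 \<le> l then ((v - 2) choose (l - 2)) * S else 0)"
proof -
  note C = balanced_converse[OF P]
  show "cover_count P T {} * l = (if 3 \<le> j then ((v - 3) choose (j - 3)) * (v * R) else 0)"
    if "T \<subseteq> {..<v}" "card T = 3"
    using cover_count_left[OF P that(1)] cover_count_left_eq_0[OF P] that l by simp
  show "cover_count P {} T * j = (if 3 \<le> l then ((v - 3) choose (l - 3)) * (v * S) else 0)"
    if "T \<subseteq> {..<v}" "card T = 3"
    using cover_count_left[OF C that(1)] cover_count_left_eq_0[OF C] that j
    by (simp add: cover_count_converse)
  show "cover_count P T {y} = (if 2 \<le> j then ((v - 2) choose (j - 2)) * R else 0)"
    if "T \<subseteq> {..<v}" "card T = 2" "y < v"
    using cover_count_left_point[OF P that(1) _ that(3)] cover_count_left_eq_0[OF P] that by simp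
  show "cover_count P {y} T = (if 2 \<le> l then ((v - 2) choose (l - 2)) * S else 0)"
    if "T \<subseteq> {..<v}" "card T = 2" "y < v"
    using cover_count_left_point[OF C that(1) _ that(3)] cover_count_left_eq_0[OF C] that
    by (simp add: cover_count_converse)
qed

lemma deg_Union:
  assumes "finite Q" "disjoint Q" "\<forall>F\<in>Q. finite F"
  shows "deg (\<Union>Q) x = (\<Sum>F\<in>Q. deg F x)"
proof -
  have "{A \<in> \<Union>Q. x \<in> A} = (\<Union>F\<in>Q. {A \<in> F. x \<in> A})"
    by auto
  moreover have "card (\<Union>F\<in>Q. {A \<in> F. x \<in> A}) = (\<Sum>F\<in>Q. card {A \<in> F. x \<in> A})"
    by (rule card_UN_disjoint) (use assms in \<open>auto simp: disjoint_def\<close>)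
  ultimately show ?thesis by (simp add: deg_def)
qed

definition blowup :: "('a set \<times> 'b set) set \<Rightarrow> ('a \<times> 'b) set" where
  "blowup E = (\<Union>(F, G)\<in>E. F \<times> G)"

lemma blowup_converse: "blowup (E\<inverse>) = (blowup E)\<inverse>"
  by (auto simp: blowup_def)

lemma blowup_Image:
  assumes "partition_on \<A> Q" "E \<subseteq> Q \<times> Q'" "F \<in> Q" "A \<in> F"
  shows "blowup E `` {A} = \<Union>(E `` {F})"
proof -
  have "F' = F" if "F' \<in> Q" "A \<in> F'" for F'
    using that assms by (auto simp: partition_on_def disjoint_def)
  then show ?thesis
    using assms(2,4) unfolding blowup_def by fastforce
qed

text \<open>The partners of \<open>A\<close> are the members of the classes adjacent to the class of \<open>A\<close>, so the degree of a
point is the sum of the degrees of these classes. The degrees \<open>s G\<close> on one side may vary, as long as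
their sums over neighbourhoods do not.\<close>

lemma balanced_blowup:
  assumes Q1: "partition_on (ksubsets v j) Q1" "\<forall>F\<in>Q1. regular v r F"
    and Q2: "partition_on (ksubsets v l) Q2" "\<forall>G\<in>Q2. regular v (s G) G"
    and E: "E \<subseteq> Q1 \<times> Q2" "\<forall>F\<in>Q1. sum s (E `` {F}) = R" "\<forall>G\<in>Q2. card (E\<inverse> `` {G}) = e"
  shows "balanced v j l R (e * r) (blowup E)"
proof -
  have fin: "finite Q1" "finite Q2"
    using finite_elements[OF finite_ksubsets] Q1(1) Q2(1) by auto
  have finF: "\<forall>F\<in>Q1. finite F" "\<forall>G\<in>Q2. finite G"
    using finite_ksubsets finite_subset Union_upper partition_onD1[OF Q1(1)] partition_onD1[OF Q2(1)] by metis+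
  have dj: "disjoint Q1" "disjoint Q2"
    using partition_onD2 Q1(1) Q2(1) by auto
  have Econv: "E\<inverse> \<subseteq> Q2 \<times> Q1" using E(1) by auto
  show ?thesis
    unfolding balanced_def
  proof (intro conjI ballI)
    show "blowup E \<subseteq> ksubsets v j \<times> ksubsets v l"
      using E(1) partition_onD1[OF Q1(1)] partition_onD1[OF Q2(1)] unfolding blowup_def by fastforce
    fix A assume "A \<in> ksubsets v j"
    then obtain F where F: "F \<in> Q1" "A \<in> F" using partition_onD1[OF Q1(1)] by auto
    have sub: "E `` {F} \<subseteq> Q2" using E(1) by auto
    show "regular v R (blowup E `` {A})"
      unfolding regular_def
    proof (intro allI impI)
      fix y assume y: "y < v"
      have "deg (\<Union>(E `` {F})) y = (\<Sum>G\<in>E `` {F}. deg G y)"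
        by (rule deg_Union) (use sub fin finF dj in \<open>auto intro: finite_subset pairwise_subset\<close>)
      also have "\<dots> = sum s (E `` {F})"
        by (rule sum.cong) (use sub Q2(2) y in \<open>auto simp: regular_def\<close>)
      finally show "deg (blowup E `` {A}) y = R"
        using E(2) F blowup_Image[OF Q1(1) E(1)] by simp
    qed
  next
    fix B assume "B \<in> ksubsets v l"
    then obtain G where G: "G \<in> Q2" "B \<in> G" using partition_onD1[OF Q2(1)] by auto
    have sub: "E\<inverse> `` {G} \<subseteq> Q1" using E(1) by auto
    show "regular v (e * r) ((blowup E)\<inverse> `` {B})"
      unfolding regular_def
    proof (intro allI impI)
      fix x assume x: "x < v"
      have "deg (\<Union>(E\<inverse> `` {G})) x = (\<Sum>F\<in>E\<inverse> `` {G}. deg F x)"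
        by (rule deg_Union) (use sub fin finF dj in \<open>auto intro: finite_subset pairwise_subset\<close>)
      also have "\<dots> = (\<Sum>F\<in>E\<inverse> `` {G}. r)"
        by (rule sum.cong) (use sub Q1(2) x in \<open>auto simp: regular_def\<close>)
      finally show "deg ((blowup E)\<inverse> `` {B}) x = e * r"
        using E(3) G blowup_Image[OF Q2(1) Econv] by (simp add: blowup_converse)
    qed
  qed
qed

lemma blowup_nonempty:
  assumes "partition_on \<A> Q" "partition_on \<B> Q'" "\<B> \<noteq> {}"
    and E: "E \<subseteq> Q \<times> Q'" "\<forall>G\<in>Q'. card (E\<inverse> `` {G}) = e" "e > 0"
  shows "blowup E \<noteq> {}"
proof -
  obtain G where G: "G \<in> Q'"
    using assms(2,3) by (auto simp: partition_on_def)
  have "E\<inverse> `` {G} \<noteq> {}"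
    using E(2,3) G by (metis card.empty less_numeral_extra(3))
  then obtain F where FG: "(F, G) \<in> E" by auto
  then have "F \<noteq> {}" "G \<noteq> {}"
    using E(1) assms(1,2) by (auto simp: partition_on_def)
  then show ?thesis
    unfolding blowup_def using FG by fastforce
qed

section \<open>Resolutions\<close>

text \<open>The blocks of \<open>C\<close> form a 1-design on the union of the two copies.\<close>

definition equidegree :: "nat \<Rightarrow> nat \<Rightarrow> (nat set \<times> nat set) set \<Rightarrow> bool" where
  "equidegree v d C \<longleftrightarrow>
     (\<forall>x<v. card {p \<in> C. x \<in> fst p} = d \<and> card {p \<in> C. x \<in> snd p} = d)"

definition resolvable_pairs :: "nat \<Rightarrow> nat \<Rightarrow> (nat set \<times> nat set) set \<Rightarrow> bool" where
  "resolvable_pairs v d P \<longleftrightarrow> (\<exists>Q. partition_on P Q \<and> (\<forall>C\<in>Q. equidegree v d C))"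

lemma resolvable_empty: "resolvable_pairs v d {}"
  unfolding resolvable_pairs_def by (intro exI[of _ "{}"]) (auto simp: partition_on_def)

lemma resolvable_single: "equidegree v d C \<Longrightarrow> resolvable_pairs v d C"
  using resolvable_empty[of v d] partition_on_space[of C]
  by (cases "C = {}") (auto simp: resolvable_pairs_def intro!: exI[of _ "{C}"])

lemma resolvable_UN:
  assumes "\<And>i. i \<in> I \<Longrightarrow> resolvable_pairs v d (D i)" "disjoint_family_on D I"
  shows "resolvable_pairs v d (\<Union>i\<in>I. D i)"
proof -
  obtain Q where Q: "\<And>i. i \<in> I \<Longrightarrow> partition_on (D i) (Q i) \<and> (\<forall>C\<in>Q i. equidegree v d C)"
    using assms(1) unfolding resolvable_pairs_def by metis
  have UQ: "\<Union> (Q i) = D i" if "i \<in> I" for i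
    using Q[OF that] by (simp add: partition_on_def)
  have sub: "C \<subseteq> D i" if "i \<in> I" "C \<in> Q i" for i C
    using Q[OF that(1)] that(2) by (auto simp: partition_on_def)
  have "partition_on (\<Union>i\<in>I. D i) (\<Union>i\<in>I. Q i)"
  proof (rule partition_onI)
    show "\<Union> (\<Union>i\<in>I. Q i) = (\<Union>i\<in>I. D i)"
      using UQ by blast
    show "{} \<notin> (\<Union>i\<in>I. Q i)"
      using Q by (auto simp: partition_on_def)
    fix p q assume pq: "p \<in> (\<Union>i\<in>I. Q i)" "q \<in> (\<Union>i\<in>I. Q i)" "p \<noteq> q"
    then obtain i j where ij: "i \<in> I" "j \<in> I" "p \<in> Q i" "q \<in> Q j" by auto
    show "disjnt p q"
    proof (cases "i = j")
      case True
      then show ?thesis using Q[OF ij(1)] ij pq by (auto simp: partition_on_def disjoint_def disjnt_def)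
    next
      case False
      then have "D i \<inter> D j = {}" using assms(2) ij by (auto simp: disjoint_family_on_def)
      then show ?thesis using sub[OF ij(1,3)] sub[OF ij(2,4)] by (auto simp: disjnt_def)
    qed
  qed
  then show ?thesis
    unfolding resolvable_pairs_def using Q by blast
qed

lemma resolvable_Un:
  assumes "resolvable_pairs v d P" "resolvable_pairs v d P'" "P \<inter> P' = {}"
  shows "resolvable_pairs v d (P \<union> P')"
proof -
  have "resolvable_pairs v d (\<Union>b\<in>{True, False}. if b then P else P')"
    by (rule resolvable_UN) (use assms in \<open>auto simp: disjoint_family_on_def\<close>)
  then show ?thesis by (simp add: Un_commute)
qed

lemma equidegree_Un:
  assumes "equidegree v c C" "equidegree v d D" "finite C" "finite D" "C \<inter> D = {}"
  shows "equidegree v (c + d) (C \<union> D)"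
proof -
  have "card {p \<in> C \<union> D. f p} = card {p \<in> C. f p} + card {p \<in> D. f p}" for f
  proof -
    have "{p \<in> C \<union> D. f p} = {p \<in> C. f p} \<union> {p \<in> D. f p}" by auto
    then show ?thesis using assms(3-5) by (simp add: card_Un_disjoint disjoint_iff)
  qed
  then show ?thesis using assms(1,2) by (simp add: equidegree_def)
qed

text \<open>Classes that cover every point only half as often as required are merged in pairs.\<close>

lemma resolvable_by_pairing:
  assumes "finite I" "even (card I)" "disjoint_family_on D I"
    and "\<And>i. i \<in> I \<Longrightarrow> equidegree v d (D i) \<and> finite (D i)"
  shows "resolvable_pairs v (2 * d) (\<Union>i\<in>I. D i)"
  using assms
proof (induction "card I" arbitrary: I rule: less_induct)
  case (less I)
  show ?case
  proof (cases "I = {}")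
    case True
    then show ?thesis using resolvable_empty by simp
  next
    case False
    then obtain a where a: "a \<in> I" by auto
    have "I \<noteq> {a}"
      using less.prems(2) by auto
    then obtain b where b: "b \<in> I" "b \<noteq> a"
      using a by auto
    define K where "K = I - {a} - {b}"
    have I: "I = insert a (insert b K)" using a b by (auto simp: K_def)
    have "card I = card K + 2"
      using less.prems(1) a b card_Suc_Diff1[of I a] card_Suc_Diff1[of "I - {a}" b] by (simp add: K_def)
    then have K: "card K < card I" "even (card K)" "finite K" using less.prems(1,2) by (auto simp: K_def)
    have 1: "resolvable_pairs v (2 * d) (\<Union>i\<in>K. D i)"
      by (rule less.hyps) (use K less.prems in \<open>auto simp: K_def disjoint_family_on_def\<close>)
    have "equidegree v (d + d) (D a \<union> D b)"
      by (rule equidegree_Un) (use a b less.prems in \<open>auto simp: disjoint_family_on_def\<close>)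
    then have 2: "resolvable_pairs v (2 * d) (D a \<union> D b)"
      using resolvable_single by (simp add: mult_2)
    have "resolvable_pairs v (2 * d) ((\<Union>i\<in>K. D i) \<union> (D a \<union> D b))"
      by (rule resolvable_Un[OF 1 2]) (use a b less.prems(3) in \<open>auto simp: K_def disjoint_family_on_def\<close>)
    moreover have "(\<Union>i\<in>K. D i) \<union> (D a \<union> D b) = (\<Union>i\<in>I. D i)"
      unfolding I by auto
    ultimately show ?thesis by simp
  qed
qed

lemma card_product_degree_left:
  "card {p \<in> F \<times> G. x \<in> fst p} = deg F x * card G"
proof -
  have "{p \<in> F \<times> G. x \<in> fst p} = {A \<in> F. x \<in> A} \<times> G" by auto
  then show ?thesis by (simp add: deg_def card_cartesian_product)
qed

lemma card_product_degree_right: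
  "card {p \<in> F \<times> G. x \<in> snd p} = card F * deg G x"
proof -
  have "{p \<in> F \<times> G. x \<in> snd p} = F \<times> {B \<in> G. x \<in> B}" by auto
  then show ?thesis by (simp add: deg_def card_cartesian_product)
qed

lemma equidegree_product:
  assumes "regular v r F" "regular v s G" "r * card G = d" "card F * s = d"
  shows "equidegree v d (F \<times> G)"
  using assms by (simp add: equidegree_def card_product_degree_left card_product_degree_right regular_def)

lemma card_converse_degree:
  "card {p \<in> C\<inverse>. x \<in> fst p} = card {p \<in> C. x \<in> snd p}"
  "card {p \<in> C\<inverse>. x \<in> snd p} = card {p \<in> C. x \<in> fst p}"
proof -
  have "{p \<in> C\<inverse>. x \<in> fst p} = prod.swap ` {p \<in> C. x \<in> snd p}"
    "{p \<in> C\<inverse>. x \<in> snd p} = prod.swap ` {p \<in> C. x \<in> fst p}" by force+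
  then show "card {p \<in> C\<inverse>. x \<in> fst p} = card {p \<in> C. x \<in> snd p}"
    "card {p \<in> C\<inverse>. x \<in> snd p} = card {p \<in> C. x \<in> fst p}"
    by (simp_all add: card_image)
qed

lemma equidegree_symmetric:
  assumes "finite C" "C \<inter> C\<inverse> = {}"
    and "\<And>x. x < v \<Longrightarrow> card {p \<in> C. x \<in> fst p} + card {p \<in> C. x \<in> snd p} = d"
  shows "equidegree v d (C \<union> C\<inverse>)"
proof -
  have "card {p \<in> C \<union> C\<inverse>. f p} = card {p \<in> C. f p} + card {p \<in> C\<inverse>. f p}" for f
  proof -
    have "{p \<in> C \<union> C\<inverse>. f p} = {p \<in> C. f p} \<union> {p \<in> C\<inverse>. f p}" by auto
    then show ?thesis using assms(1,2) by (simp add: card_Un_disjoint disjoint_iff)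
  qed
  then show ?thesis using assms(3) by (simp add: equidegree_def card_converse_degree add.commute)
qed

lemma equidegree_symmetric_product:
  assumes "finite F" "finite G" "F \<inter> G = {}" "regular v r F" "regular v s G"
    "r * card G + card F * s = d"
  shows "equidegree v d (F \<times> G \<union> (F \<times> G)\<inverse>)"
  by (rule equidegree_symmetric)
    (use assms in \<open>auto simp: card_product_degree_left card_product_degree_right regular_def\<close>)

text \<open>A product together with its mirror image may cover each point twice too often. Cut both factors
into halves and take the two products of corresponding halves as one class, the two products of
opposite halves as the other. Every member of \<open>F\<close> has the same number of partners in
either class, and so has every member of \<open>G\<close>; hence each class has half of all degrees, although the
halves themselves need not be regular.\<close>

lemma resolvable_symmetric_product:
  assumes fin: "finite F" "finite G" and FG: "F \<inter> G = {}" and reg: "regular v r F" "regular v s G"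
    and half: "card F = 2 * f" "card G = 2 * g" and d: "r * g + f * s = d"
  shows "resolvable_pairs v d (F \<times> G \<union> (F \<times> G)\<inverse>)"
proof -
  obtain F1 where F1: "F1 \<subseteq> F" "card F1 = f"
    using half obtain_subset_with_card_n[of f F] by auto
  obtain G1 where G1: "G1 \<subseteq> G" "card G1 = g"
    using half obtain_subset_with_card_n[of g G] by auto
  define F2 where "F2 = F - F1"
  define G2 where "G2 = G - G1"
  have finF: "finite F1" "finite F2" "finite G1" "finite G2"
    using F1 G1 fin finite_subset by (auto simp: F2_def G2_def)
  have cards: "card F2 = f" "card G2 = g"
    using F1 G1 half finF by (auto simp: F2_def G2_def card_Diff_subset)
  have F: "F = F1 \<union> F2" "F1 \<inter> F2 = {}" and G: "G = G1 \<union> G2" "G1 \<inter> G2 = {}"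
    using F1 G1 by (auto simp: F2_def G2_def)
  have degF: "deg F1 x + deg F2 x = deg F x" for x
  proof -
    have "{A \<in> F. x \<in> A} = {A \<in> F1. x \<in> A} \<union> {A \<in> F2. x \<in> A}" using F by auto
    then show ?thesis unfolding deg_def using finF F by (simp add: card_Un_disjoint disjoint_iff)
  qed
  have degG: "deg G1 x + deg G2 x = deg G x" for x
  proof -
    have "{A \<in> G. x \<in> A} = {A \<in> G1. x \<in> A} \<union> {A \<in> G2. x \<in> A}" using G by auto
    then show ?thesis unfolding deg_def using finF G by (simp add: card_Un_disjoint disjoint_iff)
  qed
  have main: "equidegree v d (C \<union> C\<inverse>)"
    if C: "C = F1 \<times> Ga \<union> F2 \<times> Gb" and Gab: "{Ga, Gb} = {G1, G2}" for C Ga Gb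
  proof (rule equidegree_symmetric)
    have Gx: "finite Ga" "finite Gb" "card Ga = g" "card Gb = g" "Ga \<subseteq> G" "Gb \<subseteq> G"
      using Gab finF cards G1 G by (auto simp: doubleton_eq_iff)
    have degab: "deg Ga x + deg Gb x = deg G x" for x
      using Gab degG[of x] by (auto simp: doubleton_eq_iff)
    show "finite C" using C finF Gx by simp
    show "C \<inter> C\<inverse> = {}" using C FG F Gx by auto
    fix x assume x: "x < v"
    have split: "card {p \<in> C. h p} = card {p \<in> F1 \<times> Ga. h p} + card {p \<in> F2 \<times> Gb. h p}" for h
    proof -
      have "{p \<in> C. h p} = {p \<in> F1 \<times> Ga. h p} \<union> {p \<in> F2 \<times> Gb. h p}" using C by auto
      then show ?thesis using finF Gx F(2)
        by (simp only:) (subst card_Un_disjoint; auto)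
    qed
    have "card {p \<in> C. x \<in> fst p} = (deg F1 x + deg F2 x) * g"
      unfolding split card_product_degree_left Gx by (simp add: algebra_simps)
    also have "\<dots> = r * g"
      using degF reg x by (simp add: regular_def)
    finally have "card {p \<in> C. x \<in> fst p} = r * g" .
    moreover have "card {p \<in> C. x \<in> snd p} = f * (deg Ga x + deg Gb x)"
      unfolding split card_product_degree_right F1 cards by (simp add: algebra_simps)
    ultimately show "card {p \<in> C. x \<in> fst p} + card {p \<in> C. x \<in> snd p} = d"
      using degab reg x d by (simp add: regular_def)
  qed
  have "resolvable_pairs v d ((F1 \<times> G1 \<union> F2 \<times> G2) \<union> (F1 \<times> G1 \<union> F2 \<times> G2)\<inverse> \<union>
      ((F1 \<times> G2 \<union> F2 \<times> G1) \<union> (F1 \<times> G2 \<union> F2 \<times> G1)\<inverse>))"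
  proof (rule resolvable_Un)
    show "resolvable_pairs v d ((F1 \<times> G1 \<union> F2 \<times> G2) \<union> (F1 \<times> G1 \<union> F2 \<times> G2)\<inverse>)"
      "resolvable_pairs v d ((F1 \<times> G2 \<union> F2 \<times> G1) \<union> (F1 \<times> G2 \<union> F2 \<times> G1)\<inverse>)"
      by (rule resolvable_single, rule main, rule refl, simp add: insert_commute)+
  qed (use F G FG in auto)
  moreover have "(F1 \<times> G1 \<union> F2 \<times> G2) \<union> (F1 \<times> G1 \<union> F2 \<times> G2)\<inverse> \<union>
      ((F1 \<times> G2 \<union> F2 \<times> G1) \<union> (F1 \<times> G2 \<union> F2 \<times> G1)\<inverse>) = F \<times> G \<union> (F \<times> G)\<inverse>"
    using F G by auto
  ultimately show ?thesis by simp
qed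

lemma disjoint_products:
  assumes Q: "partition_on \<A> Q" "partition_on \<B> Q'" and E: "E \<subseteq> Q \<times> Q'"
  shows "disjoint_family_on (\<lambda>(F, G). F \<times> G) E"
  unfolding disjoint_family_on_def
proof (intro ballI impI)
  fix a b assume ab: "a \<in> E" "b \<in> E" "a \<noteq> b"
  obtain F G F' G' where FG: "a = (F, G)" "b = (F', G')" by fastforce
  have "F \<in> Q" "F' \<in> Q" "G \<in> Q'" "G' \<in> Q'" using ab E FG by auto
  then have "F \<inter> F' = {} \<or> G \<inter> G' = {}"
    using Q[THEN partition_onD2] ab FG unfolding disjoint_def by metis
  then show "(case a of (F, G) \<Rightarrow> F \<times> G) \<inter> (case b of (F, G) \<Rightarrow> F \<times> G) = {}"
    using FG by auto
qed

text \<open>A product cannot meet the mirror image of a product, since that would need a common member of \<open>\<A>\<close>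
and \<open>\<B>\<close>.\<close>

lemma disjoint_symmetric_products:
  assumes Q: "partition_on \<A> Q" "partition_on \<B> Q'" and E: "E \<subseteq> Q \<times> Q'" and disj: "\<A> \<inter> \<B> = {}"
  shows "disjoint_family_on (\<lambda>(F, G). F \<times> G \<union> (F \<times> G)\<inverse>) E"
  unfolding disjoint_family_on_def
proof (intro ballI impI)
  fix a b assume ab: "a \<in> E" "b \<in> E" "a \<noteq> b"
  obtain F G F' G' where FG: "a = (F, G)" "b = (F', G')" by fastforce
  have "F \<in> Q" "F' \<in> Q" "G \<in> Q'" "G' \<in> Q'" using ab E FG by auto
  then have "F \<subseteq> \<A>" "F' \<subseteq> \<A>" "G \<subseteq> \<B>" "G' \<subseteq> \<B>"
    using Q by (auto simp: partition_on_def)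
  then have "F \<inter> G' = {}" "F' \<inter> G = {}" using disj by auto
  moreover have "F \<times> G \<inter> F' \<times> G' = {}"
    using disjoint_products[OF Q E] ab FG unfolding disjoint_family_on_def by fastforce
  ultimately show "(case a of (F, G) \<Rightarrow> F \<times> G \<union> (F \<times> G)\<inverse>) \<inter>
      (case b of (F, G) \<Rightarrow> F \<times> G \<union> (F \<times> G)\<inverse>) = {}"
    using FG by auto
qed

lemma UN_symmetric_products: "(\<Union>(F, G)\<in>E. F \<times> G \<union> (F \<times> G)\<inverse>) = blowup E \<union> (blowup E)\<inverse>"
  by (auto simp: blowup_def)

section \<open>From balanced pairs to designs\<close>

definition block :: "nat \<Rightarrow> nat set \<times> nat set \<Rightarrow> nat set" where
  "block v p = fst p \<union> (+) v ` snd p"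

definition pairs_of_size :: "nat \<Rightarrow> nat \<Rightarrow> (nat set \<times> nat set) set" where
  "pairs_of_size v k = {p. fst p \<subseteq> {..<v} \<and> snd p \<subseteq> {..<v} \<and> card (fst p) + card (snd p) = k}"

lemma block_mem:
  assumes "p \<in> pairs_of_size v k"
  shows "x < v \<Longrightarrow> x \<in> block v p \<longleftrightarrow> x \<in> fst p" "v + x \<in> block v p \<longleftrightarrow> x \<in> snd p"
  using assms by (auto simp: block_def pairs_of_size_def)

lemma inj_on_block: "inj_on (block v) (pairs_of_size v k)"
proof (rule inj_onI)
  fix p q assume pq: "p \<in> pairs_of_size v k" "q \<in> pairs_of_size v k" "block v p = block v q"
  have "fst p = fst q"
    using block_mem(1)[OF pq(1)] block_mem(1)[OF pq(2)] pq by (auto simp: pairs_of_size_def)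
  moreover have "snd p = snd q"
    using block_mem(2)[OF pq(1)] block_mem(2)[OF pq(2)] pq by auto
  ultimately show "p = q" by (simp add: prod_eq_iff)
qed

lemma block_subset_card:
  assumes "p \<in> pairs_of_size v k"
  shows "block v p \<subseteq> {..<2 * v}" "card (block v p) = k"
proof -
  have fin: "finite (fst p)" "finite (snd p)" and sub: "fst p \<subseteq> {..<v}" "snd p \<subseteq> {..<v}"
    using assms by (auto simp: pairs_of_size_def intro: finite_subset)
  show "block v p \<subseteq> {..<2 * v}"
    using sub by (auto simp: block_def)
  have "card (block v p) = card (fst p) + card ((+) v ` snd p)"
    unfolding block_def using fin sub by (intro card_Un_disjoint) auto
  then show "card (block v p) = k"
    using assms by (simp add: card_image pairs_of_size_def)
qed

lemma size_filter_block:
  assumes "P \<subseteq> pairs_of_size v k" "finite P"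
  shows "size {#b \<in># mset_set (block v ` P). h b#} = card {p \<in> P. h (block v p)}"
proof -
  have "{b \<in> block v ` P. h b} = block v ` {p \<in> P. h (block v p)}" by auto
  moreover have "inj_on (block v) {p \<in> P. h (block v p)}"
    by (rule inj_on_subset[OF inj_on_block]) (use assms in auto)
  ultimately show ?thesis
    using assms(2) by (simp add: card_image)
qed

lemma t_design_block:
  assumes P: "P \<subseteq> pairs_of_size v k" "finite P"
    and cov: "\<And>T U. T \<subseteq> {..<v} \<Longrightarrow> U \<subseteq> {..<v} \<Longrightarrow> card T + card U = t \<Longrightarrow> cover_count P T U = lam"
  shows "t_design t (2 * v) k lam {..<2 * v} (mset_set (block v ` P))"
  unfolding t_design_def
proof (intro conjI allI impI ballI)
  fix b assume "b \<in># mset_set (block v ` P)"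
  then obtain p where "p \<in> P" "b = block v p" using P(2) by auto
  then show "b \<subseteq> {..<2 * v}" "card b = k"
    using block_subset_card[of p v k] P(1) by auto
next
  fix W :: "nat set" assume W: "W \<subseteq> {..<2 * v} \<and> card W = t"
  define T where "T = W \<inter> {..<v}"
  define U where "U = {x. x < v \<and> v + x \<in> W}"
  have fin: "finite T" "finite U" by (auto simp: T_def U_def)
  have WTU: "W = T \<union> (+) v ` U"
  proof (intro equalityI subsetI)
    fix x assume x: "x \<in> W"
    show "x \<in> T \<union> (+) v ` U"
    proof (cases "x < v")
      case False
      then have "x = v + (x - v)" "x - v < v" using x W by auto
      then have "x - v \<in> U" using x by (simp add: U_def)
      then show ?thesis using \<open>x = v + (x - v)\<close> by blast
    qed (use x in \<open>simp add: T_def\<close>)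
  qed (auto simp: T_def U_def)
  have "card W = card T + card ((+) v ` U)"
    unfolding WTU using fin by (intro card_Un_disjoint) (auto simp: T_def)
  then have card: "card T + card U = t" using W by (simp add: card_image)
  have "{p \<in> P. W \<subseteq> block v p} = {p \<in> P. T \<subseteq> fst p \<and> U \<subseteq> snd p}"
  proof (rule Collect_cong, rule conj_cong[OF refl])
    fix p assume p: "p \<in> P"
    then have "p \<in> pairs_of_size v k" using P by auto
    note mem = block_mem[OF this]
    have "T \<subseteq> block v p \<longleftrightarrow> T \<subseteq> fst p" using mem(1) by (auto simp: T_def)
    moreover have "(+) v ` U \<subseteq> block v p \<longleftrightarrow> U \<subseteq> snd p" using mem(2) by blast
    ultimately show "W \<subseteq> block v p \<longleftrightarrow> T \<subseteq> fst p \<and> U \<subseteq> snd p" unfolding WTU by blast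
  qed
  then have "size {#b \<in># mset_set (block v ` P). W \<subseteq> b#} = cover_count P T U"
    using size_filter_block[OF P] by (simp add: cover_count_def)
  also have "\<dots> = lam" by (rule cov) (use card in \<open>auto simp: T_def U_def\<close>)
  finally show "size {#b \<in># mset_set (block v ` P). W \<subseteq> b#} = lam" .
qed auto

lemma t_design_1_block:
  assumes P: "P \<subseteq> pairs_of_size v k" "finite P" and d: "equidegree v d P"
  shows "t_design 1 (2 * v) k d {..<2 * v} (mset_set (block v ` P))"
proof (rule t_design_block[OF P])
  fix T U assume TU: "T \<subseteq> {..<v}" "U \<subseteq> {..<v}" "card T + card U = 1"
  have fin: "finite T" "finite U" using TU finite_subset by auto
  have "card T = 1 \<and> card U = 0 \<or> card T = 0 \<and> card U = 1" using TU(3) by linarith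
  then consider x where "T = {x}" "U = {}" "x < v" | x where "T = {}" "U = {x}" "x < v"
    using TU fin by (auto simp: card_1_singleton_iff)
  then show "cover_count P T U = d"
    using d by cases (auto simp: cover_count_def equidegree_def)
qed

lemma sum_mset_set_disjoint_family:
  assumes "finite I" "\<And>i. i \<in> I \<Longrightarrow> finite (S i)" "disjoint_family_on S I"
  shows "(\<Sum>i\<in>I. mset_set (S i)) = mset_set (\<Union>i\<in>I. S i)"
  using assms
proof (induction I rule: finite_induct)
  case (insert a I)
  have "S a \<inter> (\<Union>i\<in>I. S i) = {}"
    using insert.hyps insert.prems(2) by (force simp: disjoint_family_on_def)
  moreover have "(\<Sum>i\<in>I. mset_set (S i)) = mset_set (\<Union>i\<in>I. S i)"
    using insert.prems by (intro insert.IH) (auto simp: disjoint_family_on_def)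
  ultimately show ?case
    using insert.hyps insert.prems(1) by (simp add: mset_set_Union)
qed simp

text \<open>At least two classes are required; this is guaranteed by giving the set of pairs as the union of two
nonempty parts that are resolved separately.\<close>

lemma exists_design_from_pairs:
  assumes P: "P1 \<union> P2 \<subseteq> pairs_of_size v k" "finite P1" "finite P2" "P1 \<inter> P2 = {}" "P1 \<noteq> {}" "P2 \<noteq> {}"
    and res: "resolvable_pairs v d P1" "resolvable_pairs v d P2"
    and cov: "\<And>T U. T \<subseteq> {..<v} \<Longrightarrow> U \<subseteq> {..<v} \<Longrightarrow> card T + card U = 3 \<Longrightarrow>
      cover_count (P1 \<union> P2) T U = lam"
    and reals: "real lam = l" "real d = s"
  shows "exists_simple_resolvable_3_design (2 * v) k l s"
proof -
  let ?P = "P1 \<union> P2"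
  obtain Q1 where Q1: "partition_on P1 Q1" "\<forall>C\<in>Q1. equidegree v d C"
    using res(1) unfolding resolvable_pairs_def by auto
  obtain Q2 where Q2: "partition_on P2 Q2" "\<forall>C\<in>Q2. equidegree v d C"
    using res(2) unfolding resolvable_pairs_def by auto
  define Q where "Q = Q1 \<union> Q2"
  have U12: "\<Union>Q1 = P1" "\<Union>Q2 = P2" "{} \<notin> Q1"
    using Q1(1) Q2(1) by (auto simp: partition_on_def)
  have Q12: "Q1 \<noteq> {}" "Q2 \<noteq> {}"
    using U12 P(5,6) by auto
  have "Q1 \<inter> Q2 = {}"
  proof (rule ccontr)
    assume "Q1 \<inter> Q2 \<noteq> {}"
    then obtain C where C: "C \<in> Q1" "C \<in> Q2" by auto
    then have "C \<subseteq> P1 \<inter> P2" using U12 by auto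
    then show False using C U12(3) P(4) by auto
  qed
  note Q12 = Q12 this
  have fin: "finite Q1" "finite Q2"
    using finite_elements Q1(1) Q2(1) P(2,3) by auto
  have UQ: "\<Union>Q = ?P" using Q1(1) Q2(1) by (auto simp: Q_def partition_on_def)
  have disjQ: "disjoint Q" unfolding Q_def
    by (rule disjoint_union) (use Q1(1) Q2(1) P(4) in \<open>auto simp: partition_on_def\<close>)
  have emptyQ: "{} \<notin> Q" using Q1(1) Q2(1) by (auto simp: Q_def partition_on_def)
  have finQ: "finite Q" using fin by (simp add: Q_def)
  have "card Q1 > 0" "card Q2 > 0" using fin Q12 by (auto simp: card_gt_0_iff)
  then have cardQ: "card Q \<ge> 2" using fin Q12 by (simp add: Q_def card_Un_disjoint)
  obtain h where h: "bij_betw h {..<card Q} Q"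
    using ex_bij_betw_nat_finite[OF finQ] by (auto simp: lessThan_atLeast0)
  have hQ: "h i \<in> Q" if "i < card Q" for i using h that by (auto simp: bij_betw_def)
  have sub: "h i \<subseteq> ?P" if "i < card Q" for i using hQ[OF that] UQ by auto
  have finh: "finite (h i)" if "i < card Q" for i
    using sub[OF that] P(2,3) finite_subset by blast
  define \<B> where "\<B> = mset_set (block v ` ?P)"
  define \<pi> where "\<pi> i = mset_set (block v ` h i)" for i
  have "t_design 3 (2 * v) k lam {..<2 * v} \<B>"
    unfolding \<B>_def by (rule t_design_block) (use P cov in auto)
  moreover have "simple_blocks \<B>"
    unfolding simple_blocks_def \<B>_def by (simp add: count_mset_set')
  moreover have "one_resolvable (2 * v) k d {..<2 * v} \<B>"
    unfolding one_resolvable_def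
  proof (intro exI[of _ "card Q"] conjI exI[of _ \<pi>] allI impI)
    have disj: "disjoint_family_on (\<lambda>i. block v ` h i) {..<card Q}"
      unfolding disjoint_family_on_def
    proof (intro ballI impI)
      fix i j assume ij: "i \<in> {..<card Q}" "j \<in> {..<card Q}" "i \<noteq> j"
      then have "h i \<noteq> h j" using h by (auto simp: bij_betw_def dest: inj_onD)
      then have "h i \<inter> h j = {}" using disjQ hQ ij by (auto simp: disjoint_def)
      moreover have "block v ` h i \<inter> block v ` h j = block v ` (h i \<inter> h j)"
        by (rule inj_on_image_Int[OF inj_on_block, symmetric]) (use sub ij P(1) in auto)
      ultimately show "block v ` h i \<inter> block v ` h j = {}" by simp
    qed
    have "(\<Sum>i<card Q. \<pi> i) = mset_set (\<Union>i<card Q. block v ` h i)"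
      unfolding \<pi>_def by (rule sum_mset_set_disjoint_family) (use disj finh in auto)
    also have "(\<Union>i<card Q. block v ` h i) = block v ` (\<Union>(h ` {..<card Q}))" by auto
    also have "\<Union>(h ` {..<card Q}) = ?P" using h UQ by (simp add: bij_betw_def)
    finally show "\<B> = (\<Sum>i<card Q. \<pi> i)" by (simp add: \<B>_def)
    fix i assume i: "i < card Q"
    show "\<pi> i \<noteq> {#}"
      using finh[OF i] hQ[OF i] emptyQ by (auto simp: \<pi>_def mset_set_empty_iff)
    show "t_design 1 (2 * v) k d {..<2 * v} (\<pi> i)"
      unfolding \<pi>_def
      by (rule t_design_1_block) (use sub[OF i] P(1) finh[OF i] hQ[OF i] Q1(2) Q2(2) in \<open>auto simp: Q_def\<close>)
  qed (rule cardQ)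
  ultimately show ?thesis
    unfolding exists_simple_resolvable_3_design_def using reals by blast
qed

lemma balanced_pairs_of_size: "balanced v j l R S P \<Longrightarrow> P \<subseteq> pairs_of_size v (j + l)"
  unfolding balanced_def pairs_of_size_def ksubsets_def by fastforce

lemma pairs_of_size_converse: "P \<subseteq> pairs_of_size v k \<Longrightarrow> P\<inverse> \<subseteq> pairs_of_size v k"
  unfolding pairs_of_size_def by (fastforce simp: add.commute)

lemma card_sum_3_cases:
  assumes "T \<subseteq> {..<v::nat}" "U \<subseteq> {..<v}" "card T + card U = 3"
  obtains (left) "card T = 3" "U = {}" | (right) "T = {}" "card U = 3"
    | (left2) y where "card T = 2" "U = {y}" "y < v" | (right2) y where "T = {y}" "card U = 2" "y < v"
proof -
  have fin: "finite T" "finite U" using assms finite_subset by auto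
  have "card T = 3 \<and> card U = 0 \<or> card T = 0 \<and> card U = 3 \<or> card T = 2 \<and> card U = 1 \<or> card T = 1 \<and> card U = 2"
    using assms(3) by linarith
  then show ?thesis
    using fin assms(1,2) that by (auto simp: card_1_singleton_iff)
qed

section \<open>Binomial coefficients as polynomials\<close>

lemma real_choose: "real (n choose k) = (\<Prod>i<k. real n - real i) / fact k"
  by (simp add: binomial_gbinomial gbinomial_prod_rev lessThan_atLeast0)

lemma real_choose_numerals:
  "real (n choose 1) = real n"
  "real (n choose 2) = real n * (real n - 1) / 2"
  "real (n choose 3) = real n * (real n - 1) * (real n - 2) / 6"
  "real (n choose 4) = real n * (real n - 1) * (real n - 2) * (real n - 3) / 24"
  "real (n choose 5) = real n * (real n - 1) * (real n - 2) * (real n - 3) * (real n - 4) / 120"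
  "real (n choose 6) = real n * (real n - 1) * (real n - 2) * (real n - 3) * (real n - 4) * (real n - 5) / 720"
  "real (n choose 8) = real n * (real n - 1) * (real n - 2) * (real n - 3) * (real n - 4) * (real n - 5)
     * (real n - 6) * (real n - 7) / 40320"
  by (simp_all add: real_choose lessThan_nat_numeral fact_numeral mult_ac)

section \<open>Even block size on twice an odd number of points\<close>

text \<open>In the graph between the \<open>a\<close> orbits of pairs and the orbits of \<open>l\<close>-sets, with \<open>l = 2 * h - 2\<close>, the
degrees are \<open>d'\<close> and \<open>m\<close>; the graph between two copies of the orbits of \<open>h\<close>-sets is regular of degree
\<open>d\<close>. The last two hypotheses say that a triple inside one copy and a triple meeting both are
covered equally often.\<close>

lemma exists_design_even_block_size:
  fixes v a h l m d d' lam :: nat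
  assumes v: "v = 2 * a + 1" "a > 0" and h: "h \<ge> 3" and l: "l + 2 = 2 * h" "l \<le> v"
    and cop: "coprime h v" "coprime l v"
    and m: "m > 0" "m \<le> a" and d': "v * (a * d') = m * (v choose l)"
    and d: "d > 0" "even d" "d * v \<le> v choose h"
    and lam3: "lam = ((v - 3) choose (l - 3)) * (v * m) + ((v - 3) choose (h - 3)) * (v * d)"
    and lam2: "lam = l * d' + 2 * m * ((v - 2) choose (l - 2)) + h * d * ((v - 2) choose (h - 2))"
  shows "exists_simple_resolvable_3_design (2 * v) (2 * h) (real lam) (real (2 * h * v))"
proof -
  have v0: "v > 0" using v by simp
  have l3: "l \<ge> 3" "l \<noteq> 2" using l h by auto
  have "coprime 2 v" using v by simp
  then obtain Q2 where Q2: "partition_on (ksubsets v 2) Q2" "\<forall>F\<in>Q2. regular v 2 F"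
    using coprime_regular_partition[OF v0] by blast
  obtain Ql where Ql: "partition_on (ksubsets v l) Ql" "\<forall>F\<in>Ql. regular v l F"
    using coprime_regular_partition[OF v0 cop(2)] by blast
  obtain Qh where Qh: "partition_on (ksubsets v h) Qh" "\<forall>F\<in>Qh. regular v h F"
    using coprime_regular_partition[OF v0 cop(1)] by blast
  have fin: "finite Q2" "finite Ql" "finite Qh"
    using finite_elements[OF finite_ksubsets] Q2(1) Ql(1) Qh(1) by auto
  have orbit_card: "card F = v" if "F \<in> Q" "partition_on (ksubsets v k) Q" "\<forall>F\<in>Q. regular v k F" "k > 0" for F Q k
  proof -
    have "F \<subseteq> ksubsets v k" using that(1,2) by (auto simp: partition_on_def)
    then show ?thesis using regular_card[of F v k k] that by auto
  qed
  have count: "card Q * v = v choose k" if "partition_on (ksubsets v k) Q" "\<forall>F\<in>Q. regular v k F" "k > 0" for Q k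
    using regular_partition_card[OF that(1) order_refl, of "\<lambda>_. k"] that(2,3) by (simp add: card_ksubsets)
  have "card Q2 * v = v * a" using count[OF Q2] v by (simp add: choose_two)
  then have card2: "card Q2 = a" using v0 by simp
  have d'_eq: "a * d' = m * card Ql"
  proof -
    have "v * (a * d') = v * (m * card Ql)"
      using d' count[OF Ql] l3 by (simp add: mult_ac)
    then show ?thesis using v0 by simp
  qed
  have "d' \<le> card Ql"
  proof -
    have "a * d' \<le> a * card Ql" unfolding d'_eq using m by simp
    then show ?thesis using v(2) by simp
  qed
  then obtain E where E: "E \<subseteq> Q2 \<times> Ql" "\<forall>F\<in>Q2. card (E `` {F}) = d'" "\<forall>G\<in>Ql. card (E\<inverse> `` {G}) = m"
    using bipartite_degrees[OF fin(1,2), of "\<lambda>_. d'" m] d'_eq card2 by auto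
  have "d * v \<le> card Qh * v" using d(3) count[OF Qh] h by simp
  then have dQ: "d \<le> card Qh" using v0 by simp
  then obtain H where H: "H \<subseteq> Qh \<times> Qh" "\<forall>F\<in>Qh. card (H `` {F}) = d" "\<forall>G\<in>Qh. card (H\<inverse> `` {G}) = d"
    using bipartite_degrees[OF fin(3,3), of "\<lambda>_. d" d] by (auto simp: mult.commute)
  define P where "P = blowup E"
  define P' where "P' = blowup H"
  have bal: "balanced v 2 l (l * d') (m * 2) P"
    unfolding P_def by (rule balanced_blowup[OF Q2 Ql E(1) _ E(3)]) (use E(2) in simp)
  have bal': "balanced v h h (h * d) (d * h) P'"
    unfolding P'_def by (rule balanced_blowup[OF Qh Qh H(1) _ H(3)]) (use H(2) in simp)
  have finP: "finite P" "finite P'" using balanced_finite bal bal' by auto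
  have Psub: "P \<subseteq> ksubsets v 2 \<times> ksubsets v l" "P' \<subseteq> ksubsets v h \<times> ksubsets v h"
    using bal bal' by (auto simp: balanced_def)
  have hl: "h \<noteq> 2" "h \<noteq> l" using h l by auto
  have dj: "P \<inter> P\<inverse> = {}" "(P \<union> P\<inverse>) \<inter> P' = {}"
    using Psub ksubsets_disjoint[of 2 l v] ksubsets_disjoint[of h 2 v] ksubsets_disjoint[of h l v] l3 hl by blast+
  show ?thesis
  proof (rule exists_design_from_pairs[where ?P1.0 = "P \<union> P\<inverse>" and ?P2.0 = P'])
    have s1: "P \<subseteq> pairs_of_size v (2 * h)"
      using balanced_pairs_of_size[OF bal] l by (simp add: add.commute)
    have s2: "P' \<subseteq> pairs_of_size v (2 * h)"
      using balanced_pairs_of_size[OF bal'] by (simp add: mult_2)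
    show "P \<union> P\<inverse> \<union> P' \<subseteq> pairs_of_size v (2 * h)"
      using s1 s2 pairs_of_size_converse[OF s1] by simp
    show "finite (P \<union> P\<inverse>)" "finite P'" using finP by auto
    show "(P \<union> P\<inverse>) \<inter> P' = {}" by (rule dj)
    have "P \<noteq> {}"
      unfolding P_def by (rule blowup_nonempty[OF Q2(1) Ql(1) ksubsets_nonempty[OF l(2)] E(1,3) m(1)])
    then show "P \<union> P\<inverse> \<noteq> {}" by simp
    have "h \<le> v" using l h by linarith
    then show "P' \<noteq> {}"
      unfolding P'_def by (rule blowup_nonempty[OF Qh(1) Qh(1) ksubsets_nonempty H(1,3) d(1)])
    have finF: "finite F" if "F \<in> Q2 \<union> Ql \<union> Qh" for F
    proof -
      have "F \<subseteq> ksubsets v 2 \<union> ksubsets v l \<union> ksubsets v h"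
        using that Q2(1) Ql(1) Qh(1) by (auto simp: partition_on_def)
      then show ?thesis by (rule finite_subset) simp
    qed
    show "resolvable_pairs v (2 * h * v) (P \<union> P\<inverse>)"
      unfolding P_def UN_symmetric_products[symmetric]
    proof (rule resolvable_UN)
      show "disjoint_family_on (\<lambda>(F, G). F \<times> G \<union> (F \<times> G)\<inverse>) E"
        by (rule disjoint_symmetric_products[OF Q2(1) Ql(1) E(1) ksubsets_disjoint]) (use l3 in simp)
      fix i assume i: "i \<in> E"
      obtain F G where FG: "i = (F, G)" "F \<in> Q2" "G \<in> Ql" using i E(1) by auto
      have "F \<inter> G = {}"
        using FG Q2(1) Ql(1) ksubsets_disjoint[of 2 l v] l3 by (auto simp: partition_on_def)
      moreover have "(l + 2) * v = 2 * h * v" by (simp only: l(1))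
      then have "2 * card G + card F * l = 2 * h * v"
        using orbit_card[OF FG(2) Q2] orbit_card[OF FG(3) Ql] l3 by (simp add: algebra_simps)
      ultimately have "equidegree v (2 * h * v) (F \<times> G \<union> (F \<times> G)\<inverse>)"
        using FG finF Q2(2) Ql(2) by (intro equidegree_symmetric_product) auto
      then show "resolvable_pairs v (2 * h * v) (case i of (F, G) \<Rightarrow> F \<times> G \<union> (F \<times> G)\<inverse>)"
        using resolvable_single FG by simp
    qed
    have "resolvable_pairs v (2 * (h * v)) (\<Union>(F, G)\<in>H. F \<times> G)"
    proof (rule resolvable_by_pairing)
      show "finite H" using H(1) fin by (meson finite_SigmaI finite_subset)
      have "H = (SIGMA F:Qh. H `` {F})" using H(1) by auto
      moreover have "card (SIGMA F:Qh. H `` {F}) = (\<Sum>F\<in>Qh. card (H `` {F}))"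
        by (rule card_SigmaI) (use fin H(1) in \<open>auto intro: finite_subset[of _ Qh]\<close>)
      ultimately have "card H = card Qh * d" using H(2) by simp
      then show "even (card H)" using d(2) by simp
      show "disjoint_family_on (\<lambda>(F, G). F \<times> G) H"
        by (rule disjoint_products[OF Qh(1) Qh(1) H(1)])
      fix i assume i: "i \<in> H"
      obtain F G where FG: "i = (F, G)" "F \<in> Qh" "G \<in> Qh" using i H(1) by auto
      show "equidegree v (h * v) (case i of (F, G) \<Rightarrow> F \<times> G) \<and> finite (case i of (F, G) \<Rightarrow> F \<times> G)"
        using FG finF equidegree_product[of v h F h G "h * v"] Qh(2) orbit_card[OF FG(2) Qh] orbit_card[OF FG(3) Qh] h
        by (simp add: mult.commute)
    qed
    then show "resolvable_pairs v (2 * h * v) P'" by (simp add: P'_def blowup_def mult.assoc)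
    fix T U assume TU: "T \<subseteq> {..<v}" "U \<subseteq> {..<v}" "card T + card U = 3"
    have cc: "cover_count (P \<union> P\<inverse> \<union> P') T U = cover_count P T U + cover_count P U T + cover_count P' T U"
      using finP dj by (simp add: cover_count_Un cover_count_converse)
    have c2: "0 < l" "(0::nat) < 2" using l3 by auto
    note c = cover_counts[OF bal c2]
    have h0: "0 < h" using h by simp
    note ch = cover_counts[OF bal' h0 h0]
    show "cover_count (P \<union> P\<inverse> \<union> P') T U = lam"
      using TU
    proof (cases rule: card_sum_3_cases)
      case left
      have "cover_count P {} T * 2 = (((v - 3) choose (l - 3)) * (v * m)) * 2"
        using c(2)[OF TU(1) left(1)] l3 by simp
      moreover have "cover_count P' T {} * h = (((v - 3) choose (h - 3)) * (v * d)) * h"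
        using ch(1)[OF TU(1) left(1)] h by simp
      ultimately show ?thesis
        unfolding cc unfolding left lam3 using c(1)[OF TU(1) left(1)] c2 h0 by simp
    next
      case right
      have "cover_count P {} U * 2 = (((v - 3) choose (l - 3)) * (v * m)) * 2"
        using c(2)[OF TU(2) right(2)] l3 by simp
      moreover have "cover_count P' {} U * h = (((v - 3) choose (h - 3)) * (v * d)) * h"
        using ch(2)[OF TU(2) right(2)] h by simp
      ultimately show ?thesis
        unfolding cc unfolding right lam3 using c(1)[OF TU(2) right(2)] c2 h0 by simp
    next
      case (left2 y)
      show ?thesis
        unfolding cc unfolding left2 using c(3,4)[OF TU(1) left2(1,3)] ch(3)[OF TU(1) left2(1,3)] lam2 l3 h
        by (simp add: algebra_simps)
    next
      case (right2 y)
      show ?thesis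
        unfolding cc unfolding right2 using c(3,4)[OF TU(2) right2(2,3)] ch(4)[OF TU(2) right2(2,3)] lam2 l3 h
        by (simp add: algebra_simps)
    qed
  qed simp_all
qed


section \<open>Block size seven\<close>

text \<open>Each orbit of 5-sets is adjacent to \<open>30 * m\<close> perfect matchings, each class of 4-sets to \<open>e\<close> orbits
of 3-sets, and \<open>R\<close> is the weighted degree of an orbit of 3-sets. The value of \<open>e\<close> is forced by
the balance between triples inside a copy and triples meeting both copies. It
is even, which allows the classes of short 4-sets to be merged in pairs.\<close>

lemma exists_design_block_size_7:
  fixes v n m d' e R lam :: nat
  assumes v: "v = 4 * n" "v \<ge> 32" and cop: "coprime 3 v" "coprime 5 v"
    and m: "m > 0" "30 * m \<le> v - 1" and d': "v * ((v - 1) * d') = 30 * m * (v choose 5)"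
    and e: "e = (v + 10) * m" and R: "R = e * (v - 3)"
    and lam3: "lam = ((v - 3) choose 2) * (v * (15 * m)) + n * R + ((v - 3) choose 1) * (v * e)"
    and lam2: "lam = 5 * d' + ((v - 2) choose 3) * (30 * m) + ((v - 2) choose 1) * R + ((v - 2) choose 2) * (3 * e)"
  shows "exists_simple_resolvable_3_design (2 * v) 7 (real lam) (real (14 * n))"
proof -
  have v0: "v > 0" and n0: "n > 0" using v by auto
  have "2 * n > 0" using n0 by simp
  have v2n: "2 * (2 * n) = v" using v by simp
  obtain Q2 where Q2: "partition_on (ksubsets v 2) Q2" "\<forall>F\<in>Q2. regular v 1 F"
    using one_factorization[OF \<open>2 * n > 0\<close>] unfolding v2n by blast
  obtain Q3 where Q3: "partition_on (ksubsets v 3) Q3" "\<forall>F\<in>Q3. regular v 3 F"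
    using coprime_regular_partition[OF v0 cop(1)] by blast
  obtain Q5 where Q5: "partition_on (ksubsets v 5) Q5" "\<forall>F\<in>Q5. regular v 5 F"
    using coprime_regular_partition[OF v0 cop(2)] by blast
  obtain L S where LS: "partition_on (ksubsets v 4) (L \<union> S)" "L \<inter> S = {}"
    "\<forall>F\<in>L. regular v 4 F" "\<forall>F\<in>S. regular v 1 F" "card S = 2 * n - 1"
    using four_subsets_partition[OF n0] unfolding v(1)[symmetric] by blast
  define s where "s G = (if G \<in> L then 4 else 1 :: nat)" for G
  have regs: "\<forall>G\<in>L \<union> S. regular v (s G) G" using LS(3,4) by (auto simp: s_def)
  have fin: "finite Q2" "finite Q3" "finite Q5" "finite L" "finite S"
    using finite_elements[OF finite_ksubsets] Q2(1) Q3(1) Q5(1) LS(1) by auto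
  have sub: "F \<in> Q2 \<Longrightarrow> F \<subseteq> ksubsets v 2" "F \<in> Q3 \<Longrightarrow> F \<subseteq> ksubsets v 3"
    "F \<in> Q5 \<Longrightarrow> F \<subseteq> ksubsets v 5" "F \<in> L \<union> S \<Longrightarrow> F \<subseteq> ksubsets v 4" for F
    using Q2(1) Q3(1) Q5(1) LS(1) by (auto simp: partition_on_def)
  have finF: "finite F" if "F \<in> Q2 \<union> Q3 \<union> Q5 \<union> L \<union> S" for F
  proof -
    have "F \<subseteq> ksubsets v 2 \<union> ksubsets v 3 \<union> ksubsets v 5 \<union> ksubsets v 4"
      using that sub by blast
    then show ?thesis by (rule finite_subset) simp
  qed
  have cardF: "F \<in> Q2 \<Longrightarrow> card F = 2 * n" "F \<in> Q3 \<Longrightarrow> card F = v" "F \<in> Q5 \<Longrightarrow> card F = v"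
    "F \<in> L \<Longrightarrow> card F = v" "F \<in> S \<Longrightarrow> card F = n" for F
    using regular_card[OF sub(1), of F 1] regular_card[OF sub(2), of F 3] regular_card[OF sub(3), of F 5]
      regular_card[OF sub(4), of F 4] regular_card[OF sub(4), of F 1] Q2(2) Q3(2) Q5(2) LS(3,4) v(1) by auto
  have "(v choose 2) * 2 = v * card Q2"
    using regular_partition_card[OF Q2(1) order_refl, of "\<lambda>_. 1"] Q2(2) by (simp add: card_ksubsets)
  moreover have "(v choose 2) * 2 = v * (v - 1)" using v by (simp add: choose_two)
  ultimately have card2: "card Q2 = v - 1" using v0 by simp
  have count5: "v choose 5 = v * card Q5"
    using regular_partition_card[OF Q5(1) order_refl, of "\<lambda>_. 5"] Q5(2) by (simp add: card_ksubsets)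
  have count3: "v choose 3 = v * card Q3"
    using regular_partition_card[OF Q3(1) order_refl, of "\<lambda>_. 3"] Q3(2) by (simp add: card_ksubsets)
  have "sum s (L \<union> S) = sum s L + sum s S" using fin LS(2) by (simp add: sum.union_disjoint)
  also have "sum s L = 4 * card L" by (simp add: s_def)
  also have "sum s S = (\<Sum>G\<in>S. 1)" by (rule sum.cong) (use LS(2) in \<open>auto simp: s_def\<close>)
  finally have count4: "(v choose 4) * 4 = v * (4 * card L + card S)"
    using regular_partition_card[OF LS(1) order_refl regs] by (simp add: card_ksubsets)
  define p where "p = card Q3"
  define x where "x = real v"
  have x32: "x \<ge> 32" using v by (simp add: x_def)
  have rv3: "real (v - 3) = x - 3" using v by (simp add: x_def of_nat_diff)
  have "x * real p = x * ((x - 1) * (x - 2) / 6)"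
  proof -
    have "x * real p = real (v choose 3)" by (simp add: count3 p_def x_def)
    then show ?thesis by (simp add: real_choose_numerals x_def)
  qed
  then have rp: "real p = (x - 1) * (x - 2) / 6" using x32 by simp
  have rS: "real (card S) = (x - 2) / 2" using LS(5) v n0 by (simp add: x_def of_nat_diff)
  have rm: "real m \<le> (x - 1) / 30"
  proof -
    have "real (30 * m) \<le> real (v - 1)" using m(2) by (simp only: of_nat_le_iff)
    then show ?thesis using v by (simp add: x_def of_nat_diff)
  qed
  have re: "real e = (x + 10) * real m" by (simp add: e x_def)
  have "x * real (4 * card L + card S) = x * real (p * (v - 3))"
  proof -
    have "x * real (4 * card L + card S) = real ((v choose 4) * 4)" unfolding count4 by (simp add: x_def)
    also have "\<dots> = x * (x - 1) * (x - 2) * (x - 3) / 6" by (simp add: real_choose_numerals x_def)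
    finally show ?thesis by (simp add: rp rv3)
  qed
  then have "real (4 * card L + card S) = real (p * (v - 3))" using x32 by simp
  then have W: "4 * card L + card S = p * (v - 3)" by (simp only: of_nat_eq_iff)
  \<comment> \<open>The hypotheses of the weighted graph construction. The bound \<open>low\<close> holds because a row has
    average degree more than 3 in the columns of weight 1, the bound \<open>high\<close> because \<open>e\<close> is
    at most \<open>(v + 10) (v - 1) / 30\<close>.\<close>
  have total: "e * (4 * card L + card S) = card Q3 * R" unfolding W R p_def by simp
  have re_le: "real e \<le> (x + 10) * ((x - 1) / 30)" unfolding re using rm x32 by (intro mult_left_mono) auto
  have e_le: "e \<le> card Q3"
  proof -
    have "(x + 10) * ((x - 1) / 30) = (x - 1) * (x + 10) / 30" by simp
    also have "\<dots> \<le> (x - 1) * (5 * (x - 2)) / 30"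
      using x32 by (intro divide_right_mono mult_left_mono) auto
    also have "\<dots> = real p" by (simp add: rp)
    finally have "real e \<le> real p" using re_le by linarith
    then show ?thesis by (simp add: p_def)
  qed
  have low: "3 * card Q3 < e * card S"
  proof -
    have "real (3 * p) = (x - 1) * ((x - 2) / 2)" by (simp add: rp)
    also have "\<dots> < (x + 10) * ((x - 2) / 2)" using x32 by (intro mult_strict_right_mono) auto
    also have "\<dots> \<le> real e * ((x - 2) / 2)"
    proof -
      have "(x + 10) * 1 \<le> (x + 10) * real m" using m(1) x32 by (intro mult_left_mono) auto
      then show ?thesis unfolding re using x32 by (intro mult_right_mono) auto
    qed
    finally have "real (3 * p) < real (e * card S)" by (simp add: rS)
    then show ?thesis unfolding p_def by (simp only: of_nat_less_iff)
  qed
  have high: "e * card S + 4 * card Q3 \<le> card Q3 * (card S + 1)"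
  proof -
    have "real (e * card S + 4 * p) \<le> (x + 10) * ((x - 1) / 30) * ((x - 2) / 2) + 4 * real p"
      using mult_right_mono[OF re_le, of "(x - 2) / 2"] x32 by (simp add: rS)
    also have "\<dots> = real p * ((x + 10) / 10 + 4)" by (simp add: rp field_simps)
    also have "\<dots> \<le> real p * ((x - 2) / 2 + 1)" using x32 by (intro mult_left_mono) (simp_all add: field_simps)
    also have "\<dots> = real (p * (card S + 1))" by (simp add: rS distrib_left)
    finally have "real (e * card S + 4 * p) \<le> real (p * (card S + 1))" .
    then show ?thesis unfolding p_def by (simp only: of_nat_le_iff)
  qed
  obtain H where H: "H \<subseteq> Q3 \<times> (L \<union> S)" "\<forall>G\<in>L \<union> S. card (H\<inverse> `` {G}) = e"
    "\<forall>F\<in>Q3. (\<Sum>G\<in>H `` {F}. if G \<in> L then 4 else 1) = R"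
    by (rule weighted_bipartite_degrees[OF fin(2,4,5) LS(2) total e_le low high])
  have d'_eq: "(v - 1) * d' = 30 * m * card Q5"
  proof -
    have "v * ((v - 1) * d') = v * (30 * m * card Q5)" using d' count5 by (simp add: mult_ac)
    then show ?thesis using v0 by simp
  qed
  have "d' \<le> card Q5"
  proof -
    have "(v - 1) * d' \<le> (v - 1) * card Q5" unfolding d'_eq using m(2) by (intro mult_right_mono) auto
    then show ?thesis using v(2) by simp
  qed
  then obtain E where E: "E \<subseteq> Q2 \<times> Q5" "\<forall>F\<in>Q2. card (E `` {F}) = d'" "\<forall>G\<in>Q5. card (E\<inverse> `` {G}) = 30 * m"
    using bipartite_degrees[OF fin(1,3), of "\<lambda>_. d'" "30 * m"] d'_eq card2 by auto
  define P where "P = blowup E"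
  define P' where "P' = blowup H"
  have bal: "balanced v 2 5 (5 * d') (30 * m * 1) P"
    unfolding P_def by (rule balanced_blowup[OF Q2 Q5 E(1) _ E(3)]) (use E(2) in simp)
  have bal': "balanced v 3 4 R (e * 3) P'"
    unfolding P'_def by (rule balanced_blowup[OF Q3 LS(1) regs H(1) _ H(2)]) (use H(3) in \<open>simp add: s_def\<close>)
  have finP: "finite P" "finite P'" using balanced_finite bal bal' by auto
  have Psub: "P \<subseteq> ksubsets v 2 \<times> ksubsets v 5" "P' \<subseteq> ksubsets v 3 \<times> ksubsets v 4"
    using bal bal' by (auto simp: balanced_def)
  have k25: "ksubsets v 2 \<inter> ksubsets v 5 = {}" and k34: "ksubsets v 3 \<inter> ksubsets v 4 = {}"
    and k23: "ksubsets v 2 \<inter> ksubsets v 3 = {}" and k24: "ksubsets v 2 \<inter> ksubsets v 4 = {}"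
    by (simp_all add: ksubsets_disjoint)
  have dj: "P \<inter> P\<inverse> = {}" "P' \<inter> P'\<inverse> = {}" "(P \<union> P\<inverse>) \<inter> (P' \<union> P'\<inverse>) = {}"
    using Psub k25 k34 k23 k24 by blast+
  define D where "D = (\<lambda>(F, G). F \<times> G \<union> (F \<times> G)\<inverse> :: (nat set \<times> nat set) set)"
  have FG5: "F \<inter> G = {}" if "F \<in> Q2" "G \<in> Q5" for F G
    using sub(1)[OF that(1)] sub(3)[OF that(2)] k25 by blast
  have FG4: "F \<inter> G = {}" if "F \<in> Q3" "G \<in> L \<union> S" for F G
    using sub(2)[OF that(1)] sub(4)[OF that(2)] k34 by blast
  have res: "resolvable_pairs v (14 * n) (P \<union> P\<inverse>)"
    unfolding P_def UN_symmetric_products[symmetric] D_def[symmetric]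
  proof (rule resolvable_UN)
    show "disjoint_family_on D E"
      unfolding D_def by (rule disjoint_symmetric_products[OF Q2(1) Q5(1) E(1) k25])
    fix i assume i: "i \<in> E"
    obtain F G where FG: "i = (F, G)" "F \<in> Q2" "G \<in> Q5" using i E(1) by auto
    have "equidegree v (14 * n) (F \<times> G \<union> (F \<times> G)\<inverse>)"
      by (rule equidegree_symmetric_product[where r = 1 and s = 5])
        (use FG finF FG5 Q2(2) Q5(2) cardF v in auto)
    then show "resolvable_pairs v (14 * n) (D i)"
      using resolvable_single FG by (simp add: D_def)
  qed
  have disjH: "disjoint_family_on D H"
    unfolding D_def by (rule disjoint_symmetric_products[OF Q3(1) LS(1) H(1) k34])
  \<comment> \<open>Edges at orbits of length \<open>v\<close> cover each point \<open>28 n\<close> times and are halved; edges at short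
    classes cover each point \<open>7 n\<close> times and are merged in pairs.\<close>
  define HL where "HL = {i \<in> H. snd i \<in> L}"
  define HS where "HS = {i \<in> H. snd i \<in> S}"
  have H_split: "H = HL \<union> HS" "HL \<inter> HS = {}" using H(1) LS(2) by (auto simp: HL_def HS_def)
  have resL: "resolvable_pairs v (14 * n) (\<Union>i\<in>HL. D i)"
  proof (rule resolvable_UN)
    show "disjoint_family_on D HL" by (rule disjoint_family_on_mono[OF _ disjH]) (auto simp: HL_def)
    fix i assume i: "i \<in> HL"
    obtain F G where FG: "i = (F, G)" "F \<in> Q3" "G \<in> L" using i H(1) by (auto simp: HL_def)
    have "resolvable_pairs v (14 * n) (F \<times> G \<union> (F \<times> G)\<inverse>)"
      by (rule resolvable_symmetric_product[where r = 3 and s = 4 and f = "2 * n" and g = "2 * n"])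
        (use FG finF FG4[of F G] Q3(2) LS(3) cardF v in auto)
    then show "resolvable_pairs v (14 * n) (D i)" using FG by (simp add: D_def)
  qed
  have "resolvable_pairs v (2 * (7 * n)) (\<Union>i\<in>HS. D i)"
  proof (rule resolvable_by_pairing)
    have finH: "finite H" using H(1) fin by (meson finite_SigmaI finite_UnI finite_subset)
    then show "finite HS" by (simp add: HS_def)
    have "HS = prod.swap ` (SIGMA G:S. H\<inverse> `` {G})" by (auto simp: HS_def)
    then have "card HS = card (SIGMA G:S. H\<inverse> `` {G})" by (simp add: card_image)
    also have "\<dots> = (\<Sum>G\<in>S. card (H\<inverse> `` {G}))"
      by (rule card_SigmaI) (use fin H(1) in \<open>auto intro: finite_subset[of _ Q3]\<close>)
    also have "\<dots> = card S * e" using H(2) by simp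
    finally show "even (card HS)" using e v by simp
    show "disjoint_family_on D HS" by (rule disjoint_family_on_mono[OF _ disjH]) (auto simp: HS_def)
    fix i assume i: "i \<in> HS"
    obtain F G where FG: "i = (F, G)" "F \<in> Q3" "G \<in> S" using i H(1) by (auto simp: HS_def)
    have "equidegree v (7 * n) (F \<times> G \<union> (F \<times> G)\<inverse>)"
      by (rule equidegree_symmetric_product[where r = 3 and s = 1])
        (use FG finF FG4[of F G] Q3(2) LS(4) cardF v in auto)
    then show "equidegree v (7 * n) (D i) \<and> finite (D i)" using FG finF by (simp add: D_def)
  qed
  then have resS: "resolvable_pairs v (14 * n) (\<Union>i\<in>HS. D i)" by simp
  have "D i \<inter> D j = {}" if "i \<in> HL" "j \<in> HS" for i j
  proof -
    have "i \<in> H" "j \<in> H" "i \<noteq> j" using that H_split by auto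
    then show ?thesis using disjH by (simp add: disjoint_family_on_def)
  qed
  then have "(\<Union>i\<in>HL. D i) \<inter> (\<Union>i\<in>HS. D i) = {}" by blast
  then have "resolvable_pairs v (14 * n) ((\<Union>i\<in>HL. D i) \<union> (\<Union>i\<in>HS. D i))"
    by (rule resolvable_Un[OF resL resS])
  moreover have "(\<Union>i\<in>HL. D i) \<union> (\<Union>i\<in>HS. D i) = P' \<union> P'\<inverse>"
    unfolding P'_def UN_symmetric_products[symmetric] D_def[symmetric] H_split(1) by blast
  ultimately have res': "resolvable_pairs v (14 * n) (P' \<union> P'\<inverse>)" by simp
  show ?thesis
  proof (rule exists_design_from_pairs[OF _ _ _ dj(3) _ _ res res'])
    have s: "P \<subseteq> pairs_of_size v 7" "P' \<subseteq> pairs_of_size v 7"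
      using balanced_pairs_of_size[OF bal] balanced_pairs_of_size[OF bal'] by simp_all
    show "(P \<union> P\<inverse>) \<union> (P' \<union> P'\<inverse>) \<subseteq> pairs_of_size v 7"
      using s pairs_of_size_converse[OF s(1)] pairs_of_size_converse[OF s(2)] by simp
    show "finite (P \<union> P\<inverse>)" "finite (P' \<union> P'\<inverse>)" using finP by auto
    have "5 \<le> v" "4 \<le> v" using v by auto
    have "P \<noteq> {}"
      unfolding P_def
      by (rule blowup_nonempty[OF Q2(1) Q5(1) ksubsets_nonempty[OF \<open>5 \<le> v\<close>] E(1,3)]) (use m(1) in simp)
    then show "P \<union> P\<inverse> \<noteq> {}" by simp
    have "P' \<noteq> {}"
      unfolding P'_def
      by (rule blowup_nonempty[OF Q3(1) LS(1) ksubsets_nonempty[OF \<open>4 \<le> v\<close>] H(1,2)]) (use e m(1) v in simp)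
    then show "P' \<union> P'\<inverse> \<noteq> {}" by simp
    fix T U assume TU: "T \<subseteq> {..<v}" "U \<subseteq> {..<v}" "card T + card U = 3"
    have cc: "cover_count ((P \<union> P\<inverse>) \<union> (P' \<union> P'\<inverse>)) T U =
        cover_count P T U + cover_count P U T + cover_count P' T U + cover_count P' U T" for T U
      using finP dj by (simp add: cover_count_Un cover_count_converse)
    note c = cover_counts[OF bal] and c' = cover_counts[OF bal']
    have three: "cover_count P A {} + cover_count P {} A + cover_count P' A {} + cover_count P' {} A = lam"
      if A: "A \<subseteq> {..<v}" "card A = 3" for A
    proof -
      have "cover_count P A {} = 0" using c(1)[OF _ _ A] by simp
      moreover have "cover_count P {} A = ((v - 3) choose 2) * (v * (15 * m))" using c(2)[OF _ _ A] by simp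
      moreover have "cover_count P' A {} = n * R" using c'(1)[OF _ _ A] v(1) by simp
      moreover have "cover_count P' {} A = ((v - 3) choose 1) * (v * e)" using c'(2)[OF _ _ A] by simp
      ultimately show ?thesis by (simp only: lam3)
    qed
    have two: "cover_count P A {y} + cover_count P {y} A + cover_count P' A {y} + cover_count P' {y} A = lam"
      if A: "A \<subseteq> {..<v}" "card A = 2" "y < v" for A y
    proof -
      have "cover_count P A {y} = 5 * d'" using c(3)[OF _ _ A] by simp
      moreover have "cover_count P {y} A = ((v - 2) choose 3) * (30 * m)" using c(4)[OF _ _ A] by simp
      moreover have "cover_count P' A {y} = ((v - 2) choose 1) * R" using c'(3)[OF _ _ A] by simp
      moreover have "cover_count P' {y} A = ((v - 2) choose 2) * (3 * e)" using c'(4)[OF _ _ A] by simp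
      ultimately show ?thesis by (simp only: lam2)
    qed
    show "cover_count ((P \<union> P\<inverse>) \<union> (P' \<union> P'\<inverse>)) T U = lam"
      using TU
    proof (cases rule: card_sum_3_cases)
      case left
      then show ?thesis using three[OF TU(1)] by (simp add: cc)
    next
      case right
      then show ?thesis using three[OF TU(2)] by (simp add: cc)
    next
      case (left2 y)
      then show ?thesis using two[OF TU(1)] by (simp add: cc)
    next
      case (right2 y)
      then show ?thesis using two[OF TU(2), of y] by (simp add: cc)
    qed
  qed simp_all
qed

section \<open>Integrality of the parameters\<close>

text \<open>Divisibility by 4 gives the matchings and the half turn; 3 and 5 must not divide \<open>v\<close> for the orbits
of 3-sets and 5-sets to have full length.\<close>

lemma block_size_7_designs:
  fixes v m :: nat
  assumes v: "v \<ge> 32" "v mod 60 \<in> {4, 8, 28, 32, 44, 52}"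
    and m: "m > 0" "real m \<le> (real v - 1) / 30"
  shows "exists_simple_resolvable_3_design (2 * v) 7
    (35 / 4 * real v * (real v - 2) * (real v - 3) * real m) (7 * real v / 2)"
proof -
  have "v mod 4 = v mod 60 mod 4" "v mod 3 = v mod 60 mod 3" "v mod 5 = v mod 60 mod 5"
    by (simp_all add: mod_mod_cancel)
  then have "v mod 4 = 0" and v3: "v mod 3 \<noteq> 0" and v5: "v mod 5 \<noteq> 0"
    using v(2) by auto
  then obtain n where n: "v = 4 * n" by (metis mod_0_imp_dvd dvdE)
  have cop: "coprime 3 v" "coprime 5 v"
    using v3 v5 by (auto simp: prime_imp_coprime dvd_eq_mod_eq_0)
  have n8: "n \<ge> 8" using n v by simp
  define x where "x = real v"
  have sub: "real (v - i) = x - real i" if "i \<le> 32" for i using v that by (simp add: x_def of_nat_diff)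
  have rn: "real n = x / 4" by (simp add: x_def n)
  have m30: "30 * m \<le> v - 1"
  proof -
    have "real (30 * m) \<le> real (v - 1)" using m(2) by (simp add: sub flip: x_def)
    then show ?thesis by (simp only: of_nat_le_iff)
  qed
  define d' where "d' = m * (2 * (2 * n - 1) * (v - 3) * (n - 1))"
  have rd': "real d' = real m * ((x - 2) * (x - 3) * (x - 4) / 4)"
    using n8 by (simp add: d'_def sub of_nat_diff rn field_simps)
  define e where "e = (v + 10) * m"
  have re: "real e = (x + 10) * real m" by (simp add: e_def x_def)
  define R where "R = e * (v - 3)"
  have rR: "real R = (x + 10) * real m * (x - 3)" by (simp add: R_def re sub)
  define lam where "lam = ((v - 3) choose 2) * (v * (15 * m)) + n * R + ((v - 3) choose 1) * (v * e)"
  have choose: "real (v - 3 choose 2) = (x - 3) * (x - 4) / 2" "real (v - 3 choose 1) = x - 3"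
    "real (v - 2 choose 3) = (x - 2) * (x - 3) * (x - 4) / 6"
    "real (v - 2 choose 2) = (x - 2) * (x - 3) / 2" "real (v - 2 choose 1) = x - 2"
    unfolding real_choose_numerals by (simp_all add: sub)
  have lam_eq: "real lam = 35 / 4 * x * (x - 2) * (x - 3) * real m"
    unfolding lam_def of_nat_add of_nat_mult choose rR re rn x_def[symmetric] by (simp add: field_simps)
  have "exists_simple_resolvable_3_design (2 * v) 7 (real lam) (real (14 * n))"
  proof (rule exists_design_block_size_7[OF n v(1) cop m(1) m30 _ e_def R_def lam_def])
    have "real (v * ((v - 1) * d')) = real (30 * m * (v choose 5))"
      by (simp add: real_choose_numerals rd' sub flip: x_def)
    then show "v * ((v - 1) * d') = 30 * m * (v choose 5)" by (simp only: of_nat_eq_iff)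
    have "real lam = real (5 * d' + ((v - 2) choose 3) * (30 * m) + ((v - 2) choose 1) * R + ((v - 2) choose 2) * (3 * e))"
      unfolding lam_eq of_nat_add of_nat_mult choose rR re rd' by (simp add: field_simps)
    then show "lam = 5 * d' + ((v - 2) choose 3) * (30 * m) + ((v - 2) choose 1) * R + ((v - 2) choose 2) * (3 * e)"
      by (simp only: of_nat_eq_iff)
  qed
  moreover have "real (14 * n) = 7 * real v / 2" by (simp add: n)
  ultimately show ?thesis by (simp only: lam_eq x_def)
qed

section \<open>Numerical part\<close>

text \<open>The degrees are \<open>m * c\<close> with \<open>c = (v - 2) (v - 3) (v - 4) (v - 5) / 360\<close> for orbits of pairs, and
\<open>2 * m * b\<close> with \<open>b = (v + 3) (v - 5) / 30\<close> for orbits of 4-sets. The residues of \<open>v\<close> modulo 60 make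
\<open>b\<close> and \<open>c\<close> integers.\<close>

lemma block_size_8_designs:
  fixes v m :: nat
  assumes v: "v > 6" "v mod 60 \<in> {5, 17, 35, 47}" and m: "m > 0" "real m \<le> (real v - 1) / 2"
  shows "exists_simple_resolvable_3_design (2 * v) 8
    (7 / 30 * real v * (real v - 2) * (real v - 3) * (real v - 5) * real m) (8 * real v)"
proof -
  have v17: "v \<ge> 17"
  proof (rule ccontr)
    assume "\<not> v \<ge> 17"
    then show False using v by auto
  qed
  have "v mod 2 = v mod 60 mod 2" "v mod 3 = v mod 60 mod 3" by (simp_all add: mod_mod_cancel)
  then have "v mod 2 = 1" and v3: "v mod 3 = 2" using v(2) by auto
  then have odd: "odd v" by (simp add: odd_iff_mod_2_eq_one)
  define a where "a = (v - 1) div 2"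
  have a: "v = 2 * a + 1" "a > 0" using odd v17 by (auto simp: a_def elim: oddE)
  have ma: "m \<le> a" using m(2) a(1) by simp
  have cop2: "coprime 2 v" using odd by simp
  have "\<not> 3 dvd v" using v3 by (simp add: dvd_eq_mod_eq_0)
  then have cop3: "coprime 3 v" by (simp add: prime_imp_coprime)
  have "coprime (2 * 2) v" using cop2 by (simp only: coprime_mult_left_iff)
  then have cop4: "coprime 4 v" by simp
  have "coprime (2 * 3) v" using cop2 cop3 by (simp only: coprime_mult_left_iff)
  then have cop6: "coprime 6 v" by simp
  obtain b c where b: "(v + 3) * (v - 5) = 30 * b" and c: "(v - 2) * (v - 3) * (v - 4) * (v - 5) = 360 * c"
  proof -
    define q where "q = v div 60"
    have "v = 60 * q + 5 \<or> v = 60 * q + 17 \<or> v = 60 * q + 35 \<or> v = 60 * q + 47"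
      using v(2) div_mult_mod_eq[of v 60] unfolding q_def by fastforce
    then consider "v = 60 * q + 5" | "v = 60 * q + 17" | "v = 60 * q + 35" | "v = 60 * q + 47" by auto
    then show thesis
    proof cases
      case 1
      show thesis
        by (rule that[of "(60 * q + 8) * (2 * q)" "(20 * q + 1) * (30 * q + 1) * (60 * q + 1) * q"])
          (simp_all add: 1 algebra_simps)
    next
      case 2
      show thesis
        by (rule that[of "(6 * q + 2) * (20 * q + 4)" "(4 * q + 1) * (30 * q + 7) * (60 * q + 13) * (5 * q + 1)"])
          (simp_all add: 2 algebra_simps)
    next
      case 3
      show thesis
        by (rule that[of "(60 * q + 38) * (2 * q + 1)" "(20 * q + 11) * (15 * q + 8) * (60 * q + 31) * (2 * q + 1)"])
          (simp_all add: 3 algebra_simps)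
    next
      case 4
      show thesis
        by (rule that[of "(6 * q + 5) * (20 * q + 14)" "(4 * q + 3) * (15 * q + 11) * (60 * q + 43) * (10 * q + 7)"])
          (simp_all add: 4 algebra_simps)
    qed
  qed
  have b0: "b > 0" using b v17 by (cases b) auto
  define x where "x = real v"
  have x17: "x \<ge> 17" using v17 by (simp add: x_def)
  have sub: "real (v - i) = x - real i" if "i \<le> 17" for i using v17 that by (simp add: x_def of_nat_diff)
  have "real ((v - 2) * (v - 3) * (v - 4) * (v - 5)) = real (360 * c)" by (simp only: c)
  then have rc: "real c = (x - 2) * (x - 3) * (x - 4) * (x - 5) / 360" by (simp add: sub)
  have "real ((v + 3) * (v - 5)) = real (30 * b)" by (simp only: b)
  then have rb: "real b = (x + 3) * (x - 5) / 30" by (simp add: sub x_def)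
  have rm: "real m \<le> (x - 1) / 2" using m(2) by (simp add: x_def)
  have ra: "real a = (x - 1) / 2" using a(1) by (simp add: x_def)
  let ?d = "2 * (m * b)"
  let ?lam = "((v - 3) choose (6 - 3)) * (v * m) + ((v - 3) choose (4 - 3)) * (v * ?d)"
  have choose: "real (v - 3 choose 3) = (x - 3) * (x - 4) * (x - 5) / 6"
    "real (v - 2 choose 4) = (x - 2) * (x - 3) * (x - 4) * (x - 5) / 24"
    "real (v - 2 choose 2) = (x - 2) * (x - 3) / 2"
    by (simp_all add: real_choose_numerals sub)
  have lam_eq: "real ?lam = 7 / 30 * x * (x - 2) * (x - 3) * (x - 5) * real m"
    by (simp add: choose rb sub field_simps flip: x_def)
  have "exists_simple_resolvable_3_design (2 * v) (2 * 4) (real ?lam) (real (2 * 4 * v))"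
  proof (rule exists_design_even_block_size[where l = 6 and d' = "m * c" and d = ?d and m = m])
    show "v = 2 * a + 1" "0 < a" by (rule a)+
    show "6 \<le> v" using v17 by simp
    show "coprime 4 v" "coprime 6 v" by (rule cop4 cop6)+
    show "0 < m" "m \<le> a" using m ma by auto
    have "real (v * (a * (m * c))) = real (m * (v choose 6))"
      by (simp add: real_choose_numerals ra rc flip: x_def)
    then show "v * (a * (m * c)) = m * (v choose 6)" by (simp only: of_nat_eq_iff)
    show "0 < ?d" using m b0 by simp
    have "real (?d * v) \<le> (x - 1) * ((x + 3) * (x - 5) / 30) * x"
      using rm x17 by (simp add: rb flip: x_def)
    also have "\<dots> = x * (x - 1) * (4 * (x + 3) * (x - 5)) / 120" by (simp add: field_simps)
    also have "\<dots> \<le> x * (x - 1) * (5 * (x - 2) * (x - 3)) / 120"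
    proof -
      have "5 * (x - 2) * (x - 3) - 4 * (x + 3) * (x - 5) = x * (x - 17) + 90"
        by (simp add: algebra_simps)
      moreover have "0 \<le> x * (x - 17)" using x17 by simp
      ultimately have "4 * (x + 3) * (x - 5) \<le> 5 * (x - 2) * (x - 3)" by linarith
      then show ?thesis using x17 by (intro divide_right_mono mult_left_mono) auto
    qed
    also have "\<dots> = real (v choose 4)" by (simp add: real_choose_numerals x_def field_simps)
    finally show "?d * v \<le> v choose 4" by (simp only: of_nat_le_iff)
    have "real ?lam = real (6 * (m * c) + 2 * m * ((v - 2) choose (6 - 2)) + 4 * ?d * ((v - 2) choose (4 - 2)))"
      unfolding lam_eq by (simp add: choose rb rc field_simps)
    then show "?lam = 6 * (m * c) + 2 * m * ((v - 2) choose (6 - 2)) + 4 * ?d * ((v - 2) choose (4 - 2))"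
      by (simp only: of_nat_eq_iff)
  qed simp_all
  then show ?thesis unfolding lam_eq by (simp add: x_def)
qed

text \<open>The degrees are \<open>m * c\<close> with \<open>c = (v - 2 choose 6) / 28\<close> for orbits of pairs, and \<open>m * b\<close> with
\<open>b = (13 v + 16) (v - 6) (v - 7) / 840\<close> for orbits of 5-sets. The residues of \<open>v\<close> modulo 8, 5 and 7
make \<open>b\<close> and \<open>c\<close> integers. The degree \<open>m * b\<close> must be even: either \<open>m\<close> is, or 16 divides \<open>v - 7\<close>.\<close>

lemma block_size_10_designs:
  fixes v m :: nat
  assumes v: "v > 8" "v mod 280 \<in> {7, 23, 63, 111, 167, 191, 223, 231, 247}"
    and m: "m > 0" "real m \<le> (real v - 1) / 2" "even m \<or> 16 dvd (v - 7)"
  shows "exists_simple_resolvable_3_design (2 * v) 10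
    (81 * real v * real m / (7 * (real v - 5)) * real ((v - 2) choose 6)) (10 * real v)"
proof -
  have v23: "v \<ge> 23"
  proof (rule ccontr)
    assume "\<not> v \<ge> 23"
    then show False using v by auto
  qed
  have "v mod 8 = v mod 280 mod 8" "v mod 5 = v mod 280 mod 5" "v mod 7 = v mod 280 mod 7"
    by (simp_all add: mod_mod_cancel)
  then have m8: "v mod 8 = 7" and m5: "v mod 5 \<in> {1, 2, 3}" and m7: "v mod 7 \<in> {0, 2, 6}"
    using v(2) by auto
  have odd: "odd v" using m8 by presburger
  define a where "a = (v - 1) div 2"
  have a: "v = 2 * a + 1" "a > 0" using odd v23 by (auto simp: a_def elim: oddE)
  have ma: "m \<le> a" using m(2) a(1) by simp
  have cop2: "coprime 2 v" using odd by simp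
  have "\<not> 5 dvd v" using m5 by (auto simp: dvd_eq_mod_eq_0)
  then have cop5: "coprime 5 v" by (simp add: prime_imp_coprime)
  have "coprime (2 * 2 * 2) v" using cop2 by (simp only: coprime_mult_left_iff)
  then have cop8: "coprime 8 v" by simp
  define C where "C = (v - 2) choose 6"
  define D where "D = (v - 2) * (v - 3) * (v - 4) * (v - 5) * (v - 6) * (v - 7)"
  define x where "x = real v"
  have x23: "x \<ge> 23" using v23 by (simp add: x_def)
  have sub: "real (v - i) = x - real i" if "i \<le> 23" for i using v23 that by (simp add: x_def of_nat_diff)
  have rC: "real C = (x - 2) * (x - 3) * (x - 4) * (x - 5) * (x - 6) * (x - 7) / 720"
    by (simp add: C_def real_choose_numerals sub)
  have "real (720 * C) = real D" by (simp add: rC D_def sub)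
  then have DC: "720 * C = D" by (simp only: of_nat_eq_iff)
  \<comment> \<open>With \<open>v = 8 s + 7\<close> the factors \<open>v - 3\<close>, \<open>v - 5\<close> and \<open>v - 7\<close> contribute \<open>4\<close>, \<open>2\<close> and \<open>8\<close>.\<close>
  obtain s where s: "v = 8 * s + 7" using m8 by (metis mult_div_mod_eq)
  have s0: "s \<ge> 2" using s v23 by simp
  have "4 dvd C"
  proof -
    have "D = 64 * ((v - 2) * (2 * s + 1) * (v - 4) * (4 * s + 1) * (v - 6) * s)"
      unfolding D_def by (simp add: s algebra_simps)
    then have "16 * (45 * C) = 16 * (4 * ((v - 2) * (2 * s + 1) * (v - 4) * (4 * s + 1) * (v - 6) * s))"
      using DC by simp
    then have "45 * C = 4 * ((v - 2) * (2 * s + 1) * (v - 4) * (4 * s + 1) * (v - 6) * s)"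
      by (simp only: mult_cancel1) simp
    then have "4 dvd 45 * C" by simp
    moreover have "coprime 4 (45::nat)" by (simp add: coprime_iff_gcd_eq_1 gcd_non_0_nat)
    ultimately show ?thesis by (simp only: coprime_dvd_mult_right_iff)
  qed
  moreover have "7 dvd C"
  proof -
    have "7 dvd v - 2 \<or> 7 dvd v - 6 \<or> 7 dvd v - 7"
      using m7 v23 by auto presburger+
    then have "7 dvd D" unfolding D_def by (auto intro: dvd_mult dvd_mult2)
    then have "7 dvd 720 * C" by (simp only: DC)
    moreover have "coprime 7 (720::nat)" by (simp add: coprime_iff_gcd_eq_1 gcd_non_0_nat)
    ultimately show ?thesis by (simp only: coprime_dvd_mult_right_iff)
  qed
  moreover have "coprime 4 (7::nat)" by (simp add: coprime_iff_gcd_eq_1 gcd_non_0_nat)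
  ultimately have "4 * 7 dvd C" by (rule divides_mult)
  then obtain c where "C = 4 * 7 * c" by (rule dvdE)
  then have c: "C = 28 * c" by simp
  define K where "K = (13 * v + 16) * (v - 6) * s"
  have "3 * 5 * 7 dvd K"
  proof -
    have "3 dvd K"
    proof -
      have "3 dvd 13 * v + 16 \<or> 3 dvd v - 6 \<or> 3 dvd s" using s by presburger
      then show ?thesis unfolding K_def by (auto intro: dvd_mult dvd_mult2)
    qed
    moreover have "5 dvd K"
    proof -
      consider "v mod 5 = 1" | "v mod 5 = 2" | "v mod 5 = 3" using m5 by auto
      then have "5 dvd 13 * v + 16 \<or> 5 dvd v - 6 \<or> 5 dvd s"
      proof cases
        case 1
        then have "5 dvd v - 6" by presburger
        then show ?thesis by simp
      next
        case 2
        then have "5 dvd s" unfolding s by presburger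
        then show ?thesis by simp
      next
        case 3
        then have "5 dvd 13 * v + 16" by presburger
        then show ?thesis by simp
      qed
      then show ?thesis unfolding K_def by (auto intro: dvd_mult dvd_mult2)
    qed
    moreover have "7 dvd K"
    proof -
      consider "v mod 7 = 0" | "v mod 7 = 2" | "v mod 7 = 6" using m7 by auto
      then have "7 dvd 13 * v + 16 \<or> 7 dvd v - 6 \<or> 7 dvd s"
      proof cases
        case 1
        then have "7 dvd s" unfolding s by presburger
        then show ?thesis by simp
      next
        case 2
        then have "13 * v + 16 = 7 * (13 * (v div 7) + 6)"
          using div_mult_mod_eq[of v 7] by simp
        then have "7 dvd 13 * v + 16" by (simp only: dvd_triv_left)
        then show ?thesis by simp
      next
        case 3
        then have "7 dvd v - 6" by presburger
        then show ?thesis by simp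
      qed
      then show ?thesis unfolding K_def by (auto intro: dvd_mult dvd_mult2)
    qed
    moreover have "coprime 3 (5::nat)" "coprime (3 * 5) (7::nat)" by (simp_all add: coprime_iff_gcd_eq_1 gcd_non_0_nat)
    ultimately show ?thesis by (intro divides_mult)
  qed
  then obtain b where "K = 3 * 5 * 7 * b" by (rule dvdE)
  then have b: "K = 105 * b" by simp
  have b0: "b > 0" using b v23 s0 by (cases b) (auto simp: K_def)
  have rs: "real s = (x - 7) / 8" by (simp add: x_def s)
  have "real K = real (105 * b)" by (simp only: b)
  then have rb: "real b = (13 * x + 16) * (x - 6) * (x - 7) / 840"
    by (simp add: K_def sub rs x_def[symmetric])
  have rc: "real c = (x - 2) * (x - 3) * (x - 4) * (x - 5) * (x - 6) * (x - 7) / 20160"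
    using rC c by simp
  have rm: "real m \<le> (x - 1) / 2" using m(2) by (simp add: x_def)
  have ra: "real a = (x - 1) / 2" using a(1) by (simp add: x_def)
  have d_even: "even (m * b)"
  proof (cases "even m")
    case False
    then have "16 dvd v - 7" using m(3) by simp
    then have "even s" using s by auto
    then have "even (105 * b)" unfolding b[symmetric] K_def by simp
    then show ?thesis by simp
  qed simp
  let ?d = "m * b"
  let ?lam = "((v - 3) choose (8 - 3)) * (v * m) + ((v - 3) choose (5 - 3)) * (v * ?d)"
  have choose: "real (v - 3 choose 5) = (x - 3) * (x - 4) * (x - 5) * (x - 6) * (x - 7) / 120"
    "real (v - 3 choose 2) = (x - 3) * (x - 4) / 2"
    "real (v - 2 choose 6) = (x - 2) * (x - 3) * (x - 4) * (x - 5) * (x - 6) * (x - 7) / 720"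
    "real (v - 2 choose 3) = (x - 2) * (x - 3) * (x - 4) / 6"
    by (simp_all add: real_choose_numerals sub)
  have lam_eq: "real ?lam = 81 * x * real m / (7 * (x - 5)) * real C"
  proof -
    have cancel: "81 * x * real m / (7 * y) * (y * (w / 720)) = 81 * x * real m * w / 5040"
      if "y \<noteq> 0" for y w
      using that by (simp add: field_simps)
    have C5: "real C = (x - 5) * ((x - 2) * (x - 3) * (x - 4) * (x - 6) * (x - 7) / 720)"
      by (simp add: rC)
    have "81 * x * real m / (7 * (x - 5)) * real C =
        81 * x * real m * ((x - 2) * (x - 3) * (x - 4) * (x - 6) * (x - 7)) / 5040"
      by (subst C5, rule cancel) (use x23 in simp)
    moreover have "real ?lam = 81 * x * real m * ((x - 2) * (x - 3) * (x - 4) * (x - 6) * (x - 7)) / 5040"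
      by (simp add: choose rb field_simps flip: x_def)
    ultimately show ?thesis by simp
  qed
  have "exists_simple_resolvable_3_design (2 * v) (2 * 5) (real ?lam) (real (2 * 5 * v))"
  proof (rule exists_design_even_block_size[where l = 8 and d' = "m * c" and d = ?d and m = m])
    show "v = 2 * a + 1" "0 < a" by (rule a)+
    show "8 \<le> v" using v23 by simp
    show "coprime 5 v" "coprime 8 v" by (rule cop5 cop8)+
    show "0 < m" "m \<le> a" using m ma by auto
    have "real (v * (a * (m * c))) = real (m * (v choose 8))"
      by (simp add: real_choose_numerals ra rc flip: x_def)
    then show "v * (a * (m * c)) = m * (v choose 8)" by (simp only: of_nat_eq_iff)
    show "0 < ?d" "even ?d" using m b0 d_even by auto
    \<comment> \<open>The degree does not exceed the number of orbits; the margin is only 13 against 14.\<close>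
    have "real (?d * v) \<le> (x - 1) / 2 * ((13 * x + 16) * (x - 6) * (x - 7) / 840) * x"
      unfolding of_nat_mult rb x_def[symmetric] using rm x23 by (intro mult_right_mono) auto
    also have "\<dots> = x * (x - 1) * ((13 * x + 16) * (x - 6) * (x - 7)) / 1680" by (simp add: field_simps)
    also have "\<dots> \<le> x * (x - 1) * (14 * (x - 2) * (x - 3) * (x - 4)) / 1680"
    proof -
      have "0 \<le> x * x * x + 27 * (x * x) + (26 * x - 1008)"
      proof -
        have "23 * 23 \<le> x * x" using x23 by (intro mult_mono) auto
        moreover have "0 \<le> x * x * x" using x23 by simp
        ultimately show ?thesis using x23 by linarith
      qed
      then have "(13 * x + 16) * (x - 6) * (x - 7) \<le> 14 * (x - 2) * (x - 3) * (x - 4)"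
        by (simp add: algebra_simps)
      then show ?thesis using x23 by (intro divide_right_mono mult_left_mono) auto
    qed
    also have "\<dots> = real (v choose 5)" by (simp add: real_choose_numerals x_def field_simps)
    finally show "?d * v \<le> v choose 5" by (simp only: of_nat_le_iff)
    have "real ?lam = real (8 * (m * c) + 2 * m * ((v - 2) choose (8 - 2)) + 5 * ?d * ((v - 2) choose (5 - 2)))"
      by (simp add: choose rb rc field_simps flip: x_def)
    then show "?lam = 8 * (m * c) + 2 * m * ((v - 2) choose (8 - 2)) + 5 * ?d * ((v - 2) choose (5 - 2))"
      by (simp only: of_nat_eq_iff)
  qed simp_all
  then show ?thesis unfolding lam_eq by (simp add: x_def C_def)
qed

theorem proposition3p10:
  "(\<forall>v m :: nat.
      v \<ge> 32 \<and> v mod 60 \<in> {4, 8, 28, 32, 44, 52} \<and>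
      m > 0 \<and> real m \<le> (real v - 1) / 30 \<longrightarrow>
      exists_simple_resolvable_3_design (2 * v) 7
        (35 / 4 * real v * (real v - 2) * (real v - 3) * real m)
        (7 * real v / 2)) \<and>
   (\<forall>v m :: nat.
      v > 6 \<and> v mod 60 \<in> {5, 17, 35, 47} \<and>
      m > 0 \<and> real m \<le> (real v - 1) / 2 \<longrightarrow>
      exists_simple_resolvable_3_design (2 * v) 8
        (7 / 30 * real v * (real v - 2) * (real v - 3) * (real v - 5) * real m)
        (8 * real v)) \<and>
   (\<forall>v m :: nat.
      v > 8 \<and> v mod 280 \<in> {7, 23, 63, 111, 167, 191, 223, 231, 247} \<and>
      m > 0 \<and> real m \<le> (real v - 1) / 2 \<and> (even m \<or> 16 dvd (v - 7)) \<longrightarrow>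
      exists_simple_resolvable_3_design (2 * v) 10
        (81 * real v * real m / (7 * (real v - 5)) * real ((v - 2) choose 6))
        (10 * real v))"
  using block_size_7_designs block_size_8_designs block_size_10_designs by blast

end
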